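(* Let $G$ be a simple $4$-connected graph and let $x$ be a vertex of $G$. Then $G$ contains an induced subgraph $H$ isomorphic to a subdivision of a wheel, or of the prism $K_2 \times K_3$, or of $K_{3,3}$, such that $G-V(H)$ is connected and contains $x$.
   Context: The wheel $W_\ell$ ($\ell \ge 3$) is obtained from a cycle of length $\ell$ by adding a new vertex adjacent to all vertices of the cycle; in particular $W_3 \cong K_4$. A subdivision of a graph $P$ is obtained by replacing edges of $P$ by internally disjoint paths. $K_2 \times K_3$ is the prism (two disjoint triangles joined by a perfect matching). *)

theory Defs
  imports "Graph_Theory.Kuratowski" "Graph_Theory.Digraph_Isomorphism"
begin

text \<open>
  Simple graphs are finite, loop-free, symmetric digraphs whose arcs are pairs of vertices
  (locale \<^locale>\<open>pair_graph\<close>); an undirected edge is a pair of opposite arcs.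
\<close>

definition delete_verts :: "('a, 'b) pre_digraph \<Rightarrow> 'a set \<Rightarrow> ('a, 'b) pre_digraph" where
  "delete_verts G S = G \<restriction> (verts G - S)"

definition vertex_connected :: "nat \<Rightarrow> ('a, 'b) pre_digraph \<Rightarrow> bool" where
  "vertex_connected k G \<longleftrightarrow>
     card (verts G) > k \<and>
     (\<forall>S \<subseteq> verts G. card S < k \<longrightarrow> Digraph_Component.connected (delete_verts G S))"

text \<open>Rim vertices \<open>0, \<dots>, l - 1\<close>, hub \<open>l\<close>; meaningful for \<open>l \<ge> 3\<close>.\<close>

definition wheel :: "nat \<Rightarrow> nat pair_pre_digraph" where
  "wheel l = \<lparr> pverts = {..l},
     parcs = symcl ({(i, Suc i mod l) | i. i < l} \<union> {(l, i) | i. i < l}) \<rparr>"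

definition prism :: "nat pair_pre_digraph" where
  "prism = \<lparr> pverts = {0, 1, 2, 3, 4, 5},
     parcs = symcl ({(0, 1), (1, 2), (2, 0)} \<union> {(3, 4), (4, 5), (5, 3)}
                    \<union> {(0, 3), (1, 4), (2, 5)}) \<rparr>"

text \<open>
  The subdivision \<open>S\<close> lives on \<^typ>\<open>nat\<close>, like \<open>P\<close>, so fresh subdividing vertices
  never run out, whatever the vertex type of \<open>H\<close>.
\<close>

definition iso_to_subdivision :: "'a pair_pre_digraph \<Rightarrow> nat pair_pre_digraph \<Rightarrow> bool" where
  "iso_to_subdivision H P \<longleftrightarrow>
     (\<exists>S :: nat pair_pre_digraph.
        subdivision_pair P S \<and> digraph_iso (with_proj H) (with_proj S))"

lemma pair_graph_wheel:
  assumes "l \<ge> 3"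
  shows "pair_graph (wheel l)"
proof
  have sub: "parcs (wheel l) \<subseteq> {..l} \<times> {..l}"
    by (auto simp: wheel_def symcl_def intro: less_imp_le mod_less_divisor)
  show "finite (pverts (wheel l))" by (simp add: wheel_def)
  show "finite (parcs (wheel l))" by (rule finite_subset[OF sub]) simp
  show "fst e \<in> pverts (wheel l)" "snd e \<in> pverts (wheel l)" if "e \<in> parcs (wheel l)" for e
    using that sub by (auto simp: wheel_def)
  have "Suc i mod l \<noteq> i" if "i < l" for i
    using that assms by (cases "Suc i = l") auto
  then show "fst e \<noteq> snd e" if "e \<in> parcs (wheel l)" for e
    using that by (auto simp: wheel_def symcl_def) metis+
  show "symmetric (with_proj (wheel l))"
    by (auto simp: symmetric_def wheel_def symcl_def intro!: symI)
qed

lemma wheel_3_complete: "K\<^bsub>4\<^esub> (with_proj (wheel 3))"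
proof -
  have v: "{..3::nat} = {0, 1, 2, 3}" by auto
  have f: "{f i | i. i < (3::nat)} = {f 0, f 1, f 2}" for f :: "nat \<Rightarrow> nat \<times> nat"
  proof -
    have "{f i | i. i < (3::nat)} = f ` {..<3}" by blast
    also have "{..<3::nat} = {0, 1, 2}" by auto
    finally show ?thesis by simp
  qed
  have "parcs (wheel 3) = {(0,1),(1,2),(2,0),(3,0),(3,1),(3,2),(1,0),(2,1),(0,2),(0,3),(1,3),(2,3)}"
    unfolding wheel_def symcl_def by (simp add: f insert_commute numeral_2_eq_2)
  also have "\<dots> = {(u, v). (u, v) \<in> pverts (wheel 3) \<times> pverts (wheel 3) \<and> u \<noteq> v}"
    unfolding wheel_def v by (simp add: set_eq_iff) presburger
  finally show ?thesis
    unfolding complete_digraph_pair_def by (simp add: wheel_def)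
qed

lemma pair_graph_prism: "pair_graph prism"
proof
  show "symmetric (with_proj prism)"
    by (simp add: symmetric_def prism_def symcl_def sym_def)
qed (auto simp: prism_def symcl_def)

end

theory Submission
  imports Defs
begin

text \<open>
  Let \<open>C\<close> be a maximal connected set containing \<open>x\<close> such that \<open>G - C\<close> has a cycle. If a cycle \<open>Z\<close>
  in \<open>G - C\<close> missed a vertex, it could be rerouted through the missing part so as to free a
  neighbour of \<open>C\<close>; hence \<open>G - C\<close> is an induced cycle \<open>Z\<close>, and \<open>G - Z\<close> is connected.
  Now take \<open>B \<subseteq> G - Z - x\<close> connected with \<open>G - Z - B\<close> connected, with at least three neighbours
  on \<open>Z\<close>, and as small as possible. Counting the neighbours of a component of the
  part of \<open>B\<close> that has no neighbour in \<open>G - Z - B\<close>, 4-connectivity shows that this part is empty.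
  Therefore \<open>B\<close> is even inclusion-minimal among all connected sets with three neighbours on \<open>Z\<close>,
  so it is a vertex, an induced path, or three induced paths meeting in a vertex or a triangle, with
  few attachments to \<open>Z\<close>; in each case \<open>G[Z \<union> B]\<close> is one of the required subdivisions.
\<close>

section \<open>Suppressing vertices of degree two\<close>

text \<open>The statement wants \<open>G - Z - B\<close> connected, while the analysis of
  \<open>B\<close> wants inclusion-minimality, whatever a smaller set would leave behind. The bridge
  is that every vertex of \<open>B\<close> has a neighbour in the rest \<open>C\<close>. Given a
  connected \<open>L\<close> in \<open>B\<close> that misses \<open>v\<close>, let \<open>M\<close>
  be the component of \<open>B - v\<close> around \<open>L\<close>: then \<open>B - M\<close> is
  connected and \<open>v\<close> ties it to \<open>C\<close>, so \<open>M\<close> is a smaller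
  candidate in every respect except the number of attachments, and hence \<open>M\<close> and
  \<open>L\<close> have at most two. Four-connectivity is spent as 3 + 1: a component of
  \<open>G - Z - x\<close>, unless it and its neighbours are all of \<open>G\<close>, has four
  neighbours, of which only \<open>x\<close> can be off \<open>Z\<close>; in the counting argument,
  one neighbour out of four is given up. Subdivisions are generated by subdividing edges of a
  pattern, so explicit graphs are recognised in the opposite direction, by suppressing vertices of
  degree two. The side conditions on absent edges ensure that no suppression creates a parallel
  edge.\<close>

lemma digraph_iso_with_proj_iff:
  "digraph_iso (with_proj H) (with_proj S) \<longleftrightarrow> pair_wf_digraph H \<and>
    (\<exists>g. inj_on g (pverts H) \<and> pverts S = g ` pverts H \<and> parcs S = map_prod g g ` parcs H)"
  (is "?L \<longleftrightarrow> ?R")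
proof
  assume ?L
  then obtain f where f: "pre_digraph.digraph_isomorphism (with_proj H) f"
    and S: "with_proj S = app_iso f (with_proj H)"
    unfolding digraph_iso_def by blast
  have ht: "iso_tail f = fst" "iso_head f = snd"
    using arg_cong[OF S, of tail] arg_cong[OF S, of head] by simp_all
  have wf: "pair_wf_digraph H" and inj: "inj_on (iso_verts f) (pverts H)"
    using f by (simp_all add: pre_digraph.digraph_isomorphism_def wf_digraph_wp_iff)
  have "iso_arcs f a = map_prod (iso_verts f) (iso_verts f) a" if "a \<in> parcs H" for a
    using f that by (auto simp: pre_digraph.digraph_isomorphism_def ht prod_eq_iff)
  then have "iso_arcs f ` parcs H = map_prod (iso_verts f) (iso_verts f) ` parcs H"
    by (rule image_cong[OF refl])
  moreover have "pverts S = iso_verts f ` pverts H" "parcs S = iso_arcs f ` parcs H"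
    using arg_cong[OF S, of verts] arg_cong[OF S, of arcs] by simp_all
  ultimately show ?R using wf inj by auto
next
  assume ?R
  then obtain g where wf: "pair_wf_digraph H" and g: "inj_on g (pverts H)"
    "pverts S = g ` pverts H" "parcs S = map_prod g g ` parcs H" by blast
  define f where "f = \<lparr> iso_verts = g, iso_arcs = map_prod g g, iso_head = snd, iso_tail = fst \<rparr>"
  have "inj_on (map_prod g g) (parcs H)"
    by (rule inj_on_subset[OF map_prod_inj_on[OF g(1) g(1)]])
       (use wf in \<open>auto dest: pair_wf_digraph.in_arcsD1 pair_wf_digraph.in_arcsD2\<close>)
  then have "pre_digraph.digraph_isomorphism (with_proj H) f"
    using wf g by (simp add: pre_digraph.digraph_isomorphism_def wf_digraph_wp_iff f_def)
  moreover have "with_proj S = app_iso f (with_proj H)"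
    using g by (simp add: app_iso_def with_proj_def f_def)
  ultimately show ?L unfolding digraph_iso_def by blast
qed

text \<open>Subdividing an edge of \<open>H\<close> is copied in the subdivision \<open>S\<close> of
  \<open>P\<close> with a fresh natural number \<open>n\<close>, and the isomorphism is extended by
  sending \<open>w\<close> to \<open>n\<close>.\<close>

lemma iso_to_subdivision_subdivide:
  assumes iso: "iso_to_subdivision H P" and fin: "finite (pverts H)"
    and uv: "(u, v) \<in> parcs H" and w: "w \<notin> pverts H"
  shows "iso_to_subdivision (subdivide H (u, v) w) P"
proof -
  from iso obtain S g where S: "subdivision_pair P S" and wf: "pair_wf_digraph H"
    and g: "inj_on g (pverts H)" "pverts S = g ` pverts H" "parcs S = map_prod g g ` parcs H"
    unfolding iso_to_subdivision_def digraph_iso_with_proj_iff by blast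
  interpret H: pair_wf_digraph H by (rule wf)
  have "finite (pverts S)" using fin g by simp
  then obtain n where n: "n \<notin> pverts S" using ex_new_if_finite infinite_UNIV_nat by blast
  define h where "h = g(w := n)"
  have hg: "h a = g a" if "a \<in> pverts H" for a using that w by (auto simp: h_def)
  have hw: "h w = n" by (simp add: h_def)
  have u: "u \<in> pverts H" "v \<in> pverts H" using uv H.in_arcsD1 H.in_arcsD2 by auto
  have arcs: "map_prod h h ` X = map_prod g g ` X" if "X \<subseteq> parcs H" for X
    by (rule image_cong[OF refl]) (use that hg H.in_arcsD1 H.in_arcsD2 in auto)
  have inj: "inj_on h (insert w (pverts H))"
  proof -
    have "inj_on h (pverts H)" using g(1) hg by (simp cong: inj_on_cong)
    moreover have "h ` pverts H = pverts S" using hg by (simp add: g(2) cong: image_cong)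
    ultimately show ?thesis using n w hw by simp
  qed
  have injA: "inj_on (map_prod g g) (parcs H \<union> {(u, v), (v, u)})"
    by (rule inj_on_subset[OF map_prod_inj_on[OF g(1) g(1)]])
       (use u H.in_arcsD1 H.in_arcsD2 in auto)
  have "map_prod g g ` (parcs H - {(u, v), (v, u)})
      = map_prod g g ` parcs H - {(g u, g v), (g v, g u)}"
    by (subst inj_on_image_set_diff[OF injA]) auto
  then have arcs': "map_prod h h ` (parcs H - {(u, v), (v, u)})
      = parcs S - {(g u, g v), (g v, g u)}"
    using g arcs[of "parcs H - {(u, v), (v, u)}"] by simp
  have "(g u, g v) \<in> parcs S" using uv g by (auto intro: rev_image_eqI)
  then have "subdivision_pair P (subdivide S (g u, g v) n)"
    using S n by (intro subdivision_pair_divide)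
  moreover have "digraph_iso (with_proj (subdivide H (u, v) w))
      (with_proj (subdivide S (g u, g v) n))"
    unfolding digraph_iso_with_proj_iff
  proof (intro conjI exI[of _ h])
    show "pair_wf_digraph (subdivide H (u, v) w)"
      by (rule H.pair_wf_digraph_subdivide[OF uv w])
    show "inj_on h (pverts (subdivide H (u, v) w))" using inj by simp
    show "pverts (subdivide S (g u, g v) n) = h ` pverts (subdivide H (u, v) w)"
      using g hg hw by (simp add: image_Un cong: image_cong)
    show "parcs (subdivide S (g u, g v) n) = map_prod h h ` parcs (subdivide H (u, v) w)"
      using arcs' hg hw u by (simp add: image_Un)
  qed
  ultimately show ?thesis unfolding iso_to_subdivision_def by blast
qed

text \<open>A graph without isolated vertices is determined by its edges, each listed in either
  orientation. Equality of two such graphs thus reduces to equality of symmetric closures.\<close>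

definition ugraph :: "('a \<times> 'a) set \<Rightarrow> 'a pair_pre_digraph" where
  "ugraph E = \<lparr> pverts = Field E, parcs = symcl E \<rparr>"

lemma in_symcl_iff: "(a, b) \<in> symcl E \<longleftrightarrow> (a, b) \<in> E \<or> (b, a) \<in> E"
  by (auto simp: symcl_def)

lemma symcl_Un: "symcl (A \<union> B) = symcl A \<union> symcl B"
  by (auto simp: symcl_def)

lemma Field_symcl: "Field (symcl E) = Field E"
  by (auto simp: symcl_def Field_def)

lemma ugraph_cong: "symcl E = symcl E' \<Longrightarrow> ugraph E = ugraph E'"
  using Field_symcl[of E] Field_symcl[of E'] by (simp add: ugraph_def)

lemma ugraph_simps [simp]: "pverts (ugraph E) = Field E" "parcs (ugraph E) = symcl E"
  by (simp_all add: ugraph_def)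

lemma pair_wf_digraph_ugraph: "pair_wf_digraph (ugraph E)"
  by unfold_locales (auto simp: in_symcl_iff Field_def)

text \<open>The undivided case: the inverse of \<open>f\<close> carries the copy back to the
  pattern, which is a subdivision of itself.\<close>

lemma iso_to_subdivision_ugraph_image:
  assumes P: "pair_graph (ugraph R)" and f: "inj_on f (Field R)"
  shows "iso_to_subdivision (ugraph (map_prod f f ` R)) (ugraph R)"
proof -
  interpret P: pair_graph "ugraph R" by (rule P)
  define g where "g = the_inv_into (Field R) f"
  have gf: "g (f a) = a" if "a \<in> Field R" for a
    using that f by (simp add: g_def the_inv_into_f_f)
  have fd: "Field (map_prod f f ` R) = f ` Field R" by (force simp: Field_def)
  have sy: "symcl (map_prod f f ` R) = map_prod f f ` symcl R" by (force simp: symcl_def)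
  have "map_prod g g (map_prod f f e) = e" if "e \<in> symcl R" for e
    using that gf by (cases e) (auto simp: in_symcl_iff Field_def)
  then have "map_prod g g ` map_prod f f ` symcl R = symcl R" by force
  moreover have "g ` f ` Field R = Field R" using gf by force
  moreover have "inj_on g (f ` Field R)" using gf by (auto simp: inj_on_def)
  ultimately have "digraph_iso (with_proj (ugraph (map_prod f f ` R))) (with_proj (ugraph R))"
    unfolding digraph_iso_with_proj_iff using pair_wf_digraph_ugraph
    by (intro conjI exI[of _ g]) (simp_all add: fd sy)
  moreover have "subdivision_pair (ugraph R) (ugraph R)"
    by (rule subdivision_pair_base) unfold_locales
  ultimately show ?thesis unfolding iso_to_subdivision_def by blast
qed

text \<open>Read from conclusion to premise, the degree-two vertex \<open>w\<close> is suppressed.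
  Subdividing deletes both arcs between \<open>u\<close> and \<open>v\<close>, so \<open>F\<close>
  must not own that edge already.\<close>

lemma iso_to_subdivision_suppress_vertex:
  assumes F: "finite F" "w \<notin> Field F" "(u, v) \<notin> symcl F"
    and "u \<noteq> w" "v \<noteq> w"
    and iso: "iso_to_subdivision (ugraph (insert (u, v) F)) P"
  shows "iso_to_subdivision (ugraph (insert (u, w) (insert (w, v) F))) P"
proof -
  have "finite (pverts (ugraph (insert (u, v) F)))"
    using F by (simp add: finite_Field)
  moreover have "w \<notin> pverts (ugraph (insert (u, v) F))" using assms by (auto simp: Field_def)
  ultimately have "iso_to_subdivision (subdivide (ugraph (insert (u, v) F)) (u, v) w) P"
    using iso by (intro iso_to_subdivision_subdivide) (auto simp: symcl_def)
  moreover have "subdivide (ugraph (insert (u, v) F)) (u, v) w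
      = ugraph (insert (u, w) (insert (w, v) F))"
    unfolding subdivide.simps ugraph_def
    using F(3) by (auto simp: in_symcl_iff Field_def)
  ultimately show ?thesis by simp
qed

section \<open>Paths and cycles as vertex lists, and their suppression\<close>

definition pedges :: "'a list \<Rightarrow> ('a \<times> 'a) set" where
  "pedges xs = set (zip xs (tl xs))"

definition cedges :: "'a list \<Rightarrow> ('a \<times> 'a) set" where
  "cedges xs = insert (last xs, hd xs) (pedges xs)"

lemma pedges_simps [simp]:
  "pedges [] = {}" "pedges [a] = {}"
  "pedges (a # b # xs) = insert (a, b) (pedges (b # xs))"
  by (simp_all add: pedges_def)

lemma pedges_Cons: "xs \<noteq> [] \<Longrightarrow> pedges (a # xs) = insert (a, hd xs) (pedges xs)"
  by (cases xs) simp_all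

lemma pedges_append:
  "xs \<noteq> [] \<Longrightarrow> ys \<noteq> [] \<Longrightarrow>
    pedges (xs @ ys) = insert (last xs, hd ys) (pedges xs \<union> pedges ys)"
proof (induction xs)
  case (Cons a xs)
  then show ?case by (cases "xs = []") (auto simp: pedges_Cons)
qed simp

lemma finite_pedges [simp]: "finite (pedges xs)"
  by (simp add: pedges_def)

lemma pedgesD: "(a, b) \<in> pedges xs \<Longrightarrow> a \<in> set xs \<and> b \<in> set (tl xs)"
  by (auto simp: pedges_def dest: set_zip_leftD set_zip_rightD)

lemma pedgesD2: "(a, b) \<in> pedges xs \<Longrightarrow> b \<in> set xs"
  by (cases xs) (auto dest: pedgesD)

lemma Field_pedges_subset: "Field (pedges xs) \<subseteq> set xs"
  using pedgesD pedgesD2 by (fastforce simp: Field_def)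

lemma Field_pedges: "length xs \<ge> 2 \<Longrightarrow> Field (pedges xs) = set xs"
proof (induction xs rule: induct_list012)
  case (3 a b xs)
  then show ?case by (cases xs) (auto simp: Field_def)
qed simp_all

lemma Field_cedges: "length xs \<ge> 2 \<Longrightarrow> Field (cedges xs) = set xs"
proof -
  assume a: "length xs \<ge> 2"
  then have "Field (cedges xs) = {last xs, hd xs} \<union> set xs"
    using Field_pedges[OF a] by (auto simp: cedges_def)
  with a show ?thesis by (cases xs) auto
qed

lemma cedges_rotate: "cedges (xs @ ys) = cedges (ys @ xs)"
  by (cases "xs = []"; cases "ys = []") (auto simp: cedges_def pedges_append)

lemma pedges_rev: "symcl (pedges (rev xs)) = symcl (pedges xs)"
proof (induction xs)
  case (Cons a xs)
  show ?case
  proof (cases "xs = []")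
    case False
    then have "pedges (rev (a # xs)) = insert (hd xs, a) (pedges (rev xs))"
      by (simp add: pedges_append last_rev)
    then show ?thesis using Cons False by (auto simp: pedges_Cons symcl_def)
  qed simp
qed simp

text \<open>The induction moves the edge \<open>(u, w)\<close> into \<open>F\<close> and continues
  from \<open>w\<close>. The condition \<open>u \<noteq> v\<close> keeps the next shortcut
  \<open>(w, v)\<close> different from the edge just moved.\<close>

lemma iso_to_subdivision_suppress_path:
  assumes "finite F" "distinct ws" "set ws \<inter> Field F = {}" "u \<notin> set ws" "v \<notin> set ws"
    "u \<noteq> v" "(u, v) \<notin> symcl F"
    and "iso_to_subdivision (ugraph (insert (u, v) F)) P"
  shows "iso_to_subdivision (ugraph (pedges (u # ws @ [v]) \<union> F)) P"
  using assms
proof (induction ws arbitrary: u F)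
  case (Cons w ws)
  have "iso_to_subdivision (ugraph (insert (u, w) (insert (w, v) F))) P"
    using Cons.prems by (intro iso_to_subdivision_suppress_vertex) auto
  then have "iso_to_subdivision (ugraph (insert (w, v) (insert (u, w) F))) P"
    by (simp add: insert_commute)
  then have "iso_to_subdivision (ugraph (pedges (w # ws @ [v]) \<union> insert (u, w) F)) P"
    using Cons.prems by (intro Cons.IH) (auto simp: in_symcl_iff Field_def)
  then show ?case by simp
qed simp

lemma distinct_last_hd_notin_symcl_pedges:
  assumes "distinct xs" "length xs \<ge> 3"
  shows "(last xs, hd xs) \<notin> symcl (pedges xs)"
proof -
  obtain a b ys where xs: "xs = a # b # ys" "ys \<noteq> []"
    using assms(2) by (auto simp: numeral_3_eq_3 Suc_le_length_iff)
  have "(last xs, a) \<notin> pedges xs" using assms(1) pedgesD[of "last xs" a xs] xs by auto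
  moreover have "(a, last xs) \<notin> pedges xs"
    using assms(1) pedgesD[of a "last xs" "b # ys"] xs by auto
  ultimately show ?thesis using xs by (simp add: in_symcl_iff)
qed

text \<open>Cycle vertices outside \<open>T\<close> carry no edge of \<open>F\<close>, so they have
  degree two and can be suppressed until only \<open>T\<close> is left. Three survivors keep the
  cycle simple, and \<open>F \<inter> T \<times> T = {}\<close> prevents a shortcut from doubling an
  edge of \<open>F\<close>. The cyclic order of \<open>ts\<close> is left open: it does not matter
  for a triangle or a rim, and four branch vertices are treated by cases.\<close>

lemma iso_to_subdivision_suppress_cycle:
  assumes "finite F" "distinct zs" "T \<subseteq> set zs" "card T \<ge> 3"
    "Field F \<inter> set zs \<subseteq> T" "F \<inter> T \<times> T = {}"
  shows "\<exists>ts. distinct ts \<and> set ts = T \<and>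
    (\<forall>P. iso_to_subdivision (ugraph (cedges ts \<union> F)) P \<longrightarrow>
         iso_to_subdivision (ugraph (cedges zs \<union> F)) P)"
  using assms
proof (induction "length zs" arbitrary: zs rule: less_induct)
  case less
  show ?case
  proof (cases "set zs = T")
    case True
    then show ?thesis using less.prems by blast
  next
    case False
    then obtain w where w: "w \<in> set zs" "w \<notin> T" using less.prems by blast
    then obtain as bs where zs: "zs = as @ w # bs" by (meson split_list)
    define us where "us = bs @ as"
    \<comment> \<open>Rotating \<open>w\<close> to the front makes \<open>(last us, hd us)\<close>
      the shortcut that replaces it.\<close>
    have ce: "cedges zs = cedges (w # us)"
      unfolding zs us_def using cedges_rotate[of as "w # bs"] by simp
    have us: "distinct us" "w \<notin> set us" "T \<subseteq> set us" "set zs = insert w (set us)"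
      "length us < length zs"
      using less.prems w unfolding zs us_def by auto
    have "3 \<le> card (set us)" using less.prems us card_mono[of "set us" T] by simp
    then have len: "length us \<ge> 3" using card_length le_trans by blast
    then have ne: "us \<noteq> []" by auto
    then have hl: "hd us \<in> set us" "last us \<in> set us" by auto
    obtain ts where ts: "distinct ts" "set ts = T"
      "\<And>P. iso_to_subdivision (ugraph (cedges ts \<union> F)) P \<Longrightarrow>
         iso_to_subdivision (ugraph (cedges us \<union> F)) P"
      using less.hyps[OF us(5)] less.prems us by blast
    have FT: "(a, b) \<notin> F" if "a \<in> set us" "b \<in> set us" for a b
    proof
      assume ab: "(a, b) \<in> F"
      then have "a \<in> Field F" "b \<in> Field F" by (auto simp: Field_def)
      with that us less.prems have "a \<in> T" "b \<in> T" by auto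
      with ab less.prems show False by auto
    qed
    have "w \<notin> Field F" using w less.prems by auto
    have "iso_to_subdivision (ugraph (cedges zs \<union> F)) P"
      if "iso_to_subdivision (ugraph (cedges us \<union> F)) P" for P
    proof -
      have "iso_to_subdivision (ugraph (insert (last us, w) (insert (w, hd us) (pedges us \<union> F)))) P"
      proof (rule iso_to_subdivision_suppress_vertex)
        show "(last us, hd us) \<notin> symcl (pedges us \<union> F)"
          using distinct_last_hd_notin_symcl_pedges[OF us(1) len] FT hl
          by (auto simp: in_symcl_iff)
        show "w \<notin> Field (pedges us \<union> F)"
          using \<open>w \<notin> Field F\<close> Field_pedges_subset[of us] us by auto
      qed (use less.prems us hl that in \<open>auto simp: cedges_def\<close>)
      moreover have "cedges zs \<union> F = insert (last us, w) (insert (w, hd us) (pedges us \<union> F))"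
        unfolding ce using ne by (auto simp: cedges_def pedges_Cons)
      ultimately show ?thesis by simp
    qed
    with ts show ?thesis by blast
  qed
qed

section \<open>Explicit subdivisions\<close>

lemma notin_symclI: "a \<notin> Field X \<Longrightarrow> (a, b) \<notin> symcl X"
  by (auto simp: in_symcl_iff Field_def)

lemma pedges_conv_nth: "pedges xs = {(xs ! i, xs ! Suc i) | i. Suc i < length xs}"
  by (force simp: pedges_def set_zip nth_tl)

lemma cedges_conv_nth:
  assumes "xs \<noteq> []"
  shows "cedges xs = (\<lambda>i. (xs ! i, xs ! (Suc i mod length xs))) ` {..<length xs}"
    (is "_ = ?g ` _")
proof -
  obtain n where n: "length xs = Suc n" using assms by (cases xs) auto
  have "?g ` {..<length xs} = insert (?g n) (?g ` {..<n})"
    unfolding n by (simp add: lessThan_Suc)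
  also have "?g n = (last xs, hd xs)" using assms n by (simp add: last_conv_nth hd_conv_nth)
  also have "?g ` {..<n} = pedges xs" unfolding pedges_conv_nth using n by force
  finally show ?thesis by (simp add: cedges_def)
qed

section \<open>Wheels\<close>

lemma iso_to_subdivision_wheel_full:
  assumes zs: "distinct zs" "length zs \<ge> 3" and h: "h \<notin> set zs"
  shows "iso_to_subdivision (ugraph (cedges zs \<union> {h} \<times> set zs)) (wheel (length zs))"
proof -
  let ?l = "length zs"
  define R where "R = (\<lambda>i. (i, Suc i mod ?l)) ` {..<?l} \<union> {?l} \<times> {..<?l}"
  define f where "f = (\<lambda>i. if i < ?l then zs ! i else h)"
  have l0: "0 < ?l" using zs by linarith
  have FR: "Field R = {..?l}"
  proof
    show "Field R \<subseteq> {..?l}" using l0 by (auto simp: R_def Field_def less_imp_le)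
    have "i \<in> Field R" if "i < ?l" for i using that by (auto simp: R_def Field_def)
    moreover have "?l \<in> Field R" using l0 by (auto simp: R_def Field_def)
    ultimately show "{..?l} \<subseteq> Field R" by (auto simp: le_less)
  qed
  have "{(i, Suc i mod ?l) | i. i < ?l} = (\<lambda>i. (i, Suc i mod ?l)) ` {..<?l}"
    "{(?l, i) | i. i < ?l} = {?l} \<times> {..<?l}" by auto
  then have W: "wheel ?l = ugraph R"
    unfolding wheel_def ugraph_def using FR by (simp add: R_def)
  have "inj_on f (Field R)"
    unfolding FR using zs h by (auto simp: inj_on_def f_def nth_eq_iff_index_eq)
  then have "iso_to_subdivision (ugraph (map_prod f f ` R)) (wheel ?l)"
    using pair_graph_wheel[OF zs(2)] unfolding W by (intro iso_to_subdivision_ugraph_image)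
  moreover have "map_prod f f ` R = cedges zs \<union> {h} \<times> set zs"
  proof -
    have "map_prod f f ` (\<lambda>i. (i, Suc i mod ?l)) ` {..<?l} = cedges zs"
      unfolding image_image using l0 by (subst cedges_conv_nth) (auto simp: f_def intro!: image_cong)
    moreover have "map_prod f f ` ({?l} \<times> {..<?l}) = {h} \<times> set zs"
      by (force simp: f_def in_set_conv_nth)
    ultimately show ?thesis by (simp add: R_def image_Un)
  qed
  ultimately show ?thesis by simp
qed

text \<open>Rim vertices that miss the hub have degree two; suppressing them leaves a wheel with
  \<open>card N\<close> spokes.\<close>

lemma iso_to_subdivision_wheel_hub:
  assumes zs: "distinct zs" and N: "N \<subseteq> set zs" "card N \<ge> 3" and h: "h \<notin> set zs"
  shows "\<exists>l\<ge>3. iso_to_subdivision (ugraph (cedges zs \<union> {h} \<times> N)) (wheel l)"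
proof -
  have "finite ({h} \<times> N)" using N finite_subset by auto
  moreover have "Field ({h} \<times> N) \<inter> set zs \<subseteq> N" "{h} \<times> N \<inter> N \<times> N = {}"
    using N h by (auto simp: Field_def)
  ultimately obtain ts where ts: "distinct ts" "set ts = N"
    "\<And>P. iso_to_subdivision (ugraph (cedges ts \<union> {h} \<times> N)) P \<Longrightarrow>
         iso_to_subdivision (ugraph (cedges zs \<union> {h} \<times> N)) P"
    using iso_to_subdivision_suppress_cycle[OF _ zs N] by blast
  have "length ts \<ge> 3" using ts N distinct_card by fastforce
  moreover have "h \<notin> set ts" using ts N h by auto
  ultimately show ?thesis
    using iso_to_subdivision_wheel_full[OF ts(1)] ts by blast
qed

text \<open>A triangle contains all pairs of its vertices, so the unknown order returned by
  \<open>iso_to_subdivision_suppress_cycle\<close> is harmless here.\<close>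

lemma symcl_cedges_triple:
  assumes "distinct ts" "set ts = {p, q, r}" "p \<noteq> q" "q \<noteq> r" "p \<noteq> r"
  shows "symcl (cedges ts) = symcl {(p, q), (q, r), (r, p)}"
proof -
  have "length ts = card {p, q, r}" using assms distinct_card by metis
  then have "length ts = 3" using assms by simp
  then obtain a b c where abc: "ts = [a, b, c]"
    by (auto simp: numeral_3_eq_3 length_Suc_conv)
  have "symcl {(x, y), (y, z), (z, x)} = {x, y, z} \<times> {x, y, z} - Id"
    if "x \<noteq> y" "y \<noteq> z" "x \<noteq> z" for x y z :: 'a
    using that by (simp add: symcl_def) blast
  note tri = this
  have "symcl (cedges ts) = symcl {(a, b), (b, c), (c, a)}"
    unfolding abc by (simp add: cedges_def insert_commute)
  also have "\<dots> = set ts \<times> set ts - Id" using assms(1) tri[of a b c] by (simp add: abc)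
  also have "\<dots> = symcl {(p, q), (q, r), (r, p)}"
    by (simp only: assms(2) tri[OF assms(3,4,5)])
  finally show ?thesis .
qed

lemma pedges_between:
  "ws \<noteq> [] \<Longrightarrow> pedges (u # ws @ [v]) = insert (u, hd ws) (insert (last ws, v) (pedges ws))"
  by (simp add: pedges_Cons pedges_append insert_commute)

text \<open>The roles change: once \<open>zs\<close> is shrunk to the triangle on \<open>p\<close>,
  \<open>q\<close>, \<open>r\<close>, the vertex \<open>r\<close> becomes the hub, and
  \<open>p # bs @ [q]\<close>, closed by the triangle edge between \<open>q\<close> and
  \<open>p\<close>, becomes the rim. The triangle supplies the spokes to \<open>p\<close> and
  \<open>q\<close>, so one vertex in \<open>N\<close> already gives three spokes.\<close>

lemma iso_to_subdivision_wheel_path: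
  assumes zs: "distinct zs" "{p, q, r} \<subseteq> set zs" "p \<noteq> q" "q \<noteq> r" "p \<noteq> r"
    and bs: "distinct bs" "bs \<noteq> []" "set bs \<inter> set zs = {}"
    and N: "N \<subseteq> set bs" "N \<noteq> {}"
  shows "\<exists>l\<ge>3. iso_to_subdivision
    (ugraph (cedges zs \<union> (pedges (p # bs @ [q]) \<union> {r} \<times> N))) (wheel l)"
proof -
  let ?F = "pedges (p # bs @ [q]) \<union> {r} \<times> N"
  have finN: "finite N" using N finite_subset by auto
  have hl: "hd bs \<in> set bs" "last bs \<in> set bs" using bs by auto
  have "a \<in> set bs \<or> b \<in> set bs" if "(a, b) \<in> ?F" for a b
    using that hl N pedgesD[of a b bs] unfolding pedges_between[OF bs(2)] by auto
  then have "?F \<inter> {p, q, r} \<times> {p, q, r} = {}"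
    using zs(2) bs(3) by blast
  moreover have "Field ?F \<inter> set zs \<subseteq> {p, q, r}"
    using Field_pedges_subset[of "p # bs @ [q]"] bs N by (auto simp: Field_def)
  moreover have "card {p, q, r} \<ge> 3" "finite ?F" using zs finN by simp_all
  ultimately obtain ts where ts: "distinct ts" "set ts = {p, q, r}"
    "\<And>P. iso_to_subdivision (ugraph (cedges ts \<union> ?F)) P \<Longrightarrow>
         iso_to_subdivision (ugraph (cedges zs \<union> ?F)) P"
    using iso_to_subdivision_suppress_cycle[of ?F zs "{p, q, r}"] zs by blast
  have "symcl (cedges ts \<union> ?F) = symcl ({(p, q), (q, r), (r, p)} \<union> ?F)"
    using symcl_cedges_triple[OF ts(1,2) zs(3-5)] by (simp only: symcl_Un)
  also have "\<dots> = symcl (cedges (p # bs @ [q]) \<union> {r} \<times> (N \<union> {p, q}))"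
    unfolding cedges_def by (auto simp: in_symcl_iff)
  finally have "ugraph (cedges ts \<union> ?F) = ugraph (cedges (p # bs @ [q]) \<union> {r} \<times> (N \<union> {p, q}))"
    by (rule ugraph_cong)
  moreover have "\<exists>l\<ge>3. iso_to_subdivision
      (ugraph (cedges (p # bs @ [q]) \<union> {r} \<times> (N \<union> {p, q}))) (wheel l)"
  proof (rule iso_to_subdivision_wheel_hub)
    show "distinct (p # bs @ [q])" using bs zs by auto
    show "N \<union> {p, q} \<subseteq> set (p # bs @ [q])" using N by auto
    show "r \<notin> set (p # bs @ [q])" using bs zs by auto
    have "card (N \<union> {p, q}) = card N + 2"
      using finN N bs zs by (subst card_Un_disjoint) auto
    moreover have "card N > 0" using finN N by (simp add: card_gt_0_iff)
    ultimately show "card (N \<union> {p, q}) \<ge> 3" by linarith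
  qed
  ultimately show ?thesis using ts(3) by metis
qed

text \<open>Suppressing \<open>rs\<close> turns the third leg into the edge \<open>(r, c)\<close>,
  which is the situation of \<open>iso_to_subdivision_wheel_path\<close> with
  \<open>N = {c}\<close>.\<close>

lemma iso_to_subdivision_wheel_claw:
  assumes zs: "distinct zs" "{p, q, r} \<subseteq> set zs" "p \<noteq> q" "q \<noteq> r" "p \<noteq> r"
    and bs: "distinct bs" "set bs \<inter> set zs = {}" "c \<in> set bs"
    and rs: "distinct rs" "set rs \<inter> set zs = {}" "set rs \<inter> set bs = {}"
  shows "\<exists>l\<ge>3. iso_to_subdivision
    (ugraph (cedges zs \<union> pedges (p # bs @ [q]) \<union> pedges (r # rs @ [c]))) (wheel l)"
proof -
  let ?F = "cedges zs \<union> pedges (p # bs @ [q])"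
  have ne: "bs \<noteq> []" "{c} \<subseteq> set bs" using bs by auto
  obtain l where l: "l \<ge> 3" "iso_to_subdivision
      (ugraph (cedges zs \<union> (pedges (p # bs @ [q]) \<union> {r} \<times> {c}))) (wheel l)"
    using iso_to_subdivision_wheel_path[OF zs bs(1) ne(1) bs(2) ne(2)] by auto
  have len: "length zs \<ge> 2" using zs by (cases zs; cases "tl zs") auto
  have FF: "Field ?F \<subseteq> set zs \<union> set bs"
    using Field_pedges_subset[of "p # bs @ [q]"] Field_cedges[OF len] zs by auto
  have "(r, c) \<notin> symcl ?F"
  proof -
    have "r \<in> set zs" "c \<notin> set zs" using zs bs by auto
    then have "(r, c) \<notin> symcl (cedges zs)"
      using Field_cedges[OF len] by (auto simp: in_symcl_iff Field_def)
    moreover have "r \<notin> set (p # bs @ [q])" using zs bs by auto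
    then have "(r, c) \<notin> symcl (pedges (p # bs @ [q]))"
      using Field_pedges_subset[of "p # bs @ [q]"] by (auto simp: in_symcl_iff Field_def)
    ultimately show ?thesis by (simp add: symcl_Un)
  qed
  moreover have "finite ?F" by (simp add: cedges_def)
  moreover have "set rs \<inter> Field ?F = {}" using FF rs by blast
  moreover have "r \<notin> set rs" "c \<notin> set rs" "r \<noteq> c" using rs zs bs by auto
  moreover have "insert (r, c) ?F = cedges zs \<union> (pedges (p # bs @ [q]) \<union> {r} \<times> {c})" by auto
  ultimately have "iso_to_subdivision (ugraph (pedges (r # rs @ [c]) \<union> ?F)) (wheel l)"
    using l(2) rs(1) by (intro iso_to_subdivision_suppress_path) simp_all
  then show ?thesis using l(1) by (auto simp: Un_commute)
qed

section \<open>Prisms and \<open>K_{3,3}\<close>\<close>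

lemma iso_to_subdivision_prism_base:
  assumes "distinct [a0, a1, a2, a3, a4, a5]"
  shows "iso_to_subdivision (ugraph ({(a0, a1), (a1, a2), (a2, a0)} \<union>
    {(a3, a4), (a4, a5), (a5, a3)} \<union> {(a0, a3), (a1, a4), (a2, a5)})) prism"
proof -
  define R :: "(nat \<times> nat) set" where
    "R = {(0, 1), (1, 2), (2, 0)} \<union> {(3, 4), (4, 5), (5, 3)} \<union> {(0, 3), (1, 4), (2, 5)}"
  define f where "f = (\<lambda>i. [a0, a1, a2, a3, a4, a5] ! i)"
  have FR: "Field R = {0, 1, 2, 3, 4, 5}" by (auto simp: R_def Field_def)
  then have P: "prism = ugraph R" unfolding prism_def ugraph_def R_def by simp
  have "inj_on f (Field R)" using assms unfolding FR by (simp add: f_def)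
  then have "iso_to_subdivision (ugraph (map_prod f f ` R)) prism"
    using pair_graph_prism unfolding P by (intro iso_to_subdivision_ugraph_image)
  then show ?thesis by (simp add: R_def f_def insert_commute)
qed

lemma symcl_Times: "symcl (A \<times> B) = A \<times> B \<union> B \<times> A"
  by (auto simp: symcl_def)

lemma pair_graph_ugraph:
  assumes fin: "finite E" and irrefl: "\<And>a. (a, a) \<notin> E"
  shows "pair_graph (ugraph E)"
proof
  show "finite (pverts (ugraph E))" using fin by (simp add: finite_Field)
  show "finite (parcs (ugraph E))" using fin by (simp add: symcl_def)
  show "fst e \<noteq> snd e" if "e \<in> parcs (ugraph E)" for e
    using that irrefl by (cases e) (auto simp: in_symcl_iff)
  show "symmetric (with_proj (ugraph E))"
    by (auto simp: symmetric_def in_symcl_iff intro!: symI)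
qed (auto simp: in_symcl_iff Field_def)

lemma iso_to_subdivision_K33_base:
  assumes "distinct [a0, a1, a2, a3, a4, a5]"
  shows "\<exists>K :: nat pair_pre_digraph. complete_bipartite_digraph 3 3 (with_proj K) \<and>
    iso_to_subdivision (ugraph ({a0, a1, a2} \<times> {a3, a4, a5})) K"
proof -
  define R :: "(nat \<times> nat) set" where "R = {0, 1, 2} \<times> {3, 4, 5}"
  define f where "f = (\<lambda>i. [a0, a1, a2, a3, a4, a5] ! i)"
  have FR: "Field R = {0, 1, 2, 3, 4, 5}" by (auto simp: R_def Field_def)
  have sR: "symcl R = {0, 1, 2} \<times> {3, 4, 5} \<union> {3, 4, 5} \<times> {0, 1, 2}"
    unfolding R_def by (rule symcl_Times)
  have K: "pair_graph (ugraph R)"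
    by (rule pair_graph_ugraph) (auto simp: R_def)
  interpret K: pair_graph "ugraph R" by (rule K)
  have "inj_on f (Field R)" using assms unfolding FR by (simp add: f_def)
  then have "iso_to_subdivision (ugraph (map_prod f f ` R)) (ugraph R)"
    by (intro iso_to_subdivision_ugraph_image K)
  moreover have "map_prod f f ` R = {a0, a1, a2} \<times> {a3, a4, a5}"
    unfolding R_def map_prod_surj_on[OF refl refl] by (simp add: f_def)
  moreover have "complete_bipartite_digraph 3 3 (with_proj (ugraph R))"
    unfolding complete_bipartite_digraph_def
  proof (rule conjI[OF K.graph_axioms], rule exI[of _ "{0, 1, 2}"], rule exI[of _ "{3, 4, 5}"])
    show "verts (with_proj (ugraph R)) = {0, 1, 2} \<union> {3, 4, 5} \<and> {0, 1, 2} \<inter> {3, 4, 5 :: nat} = {} \<and>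
        card {0, 1, 2 :: nat} = 3 \<and> card {3, 4, 5 :: nat} = 3 \<and>
        arcs_ends (with_proj (ugraph R)) = {0, 1, 2} \<times> {3, 4, 5} \<union> {3, 4, 5} \<times> {0, 1, 2}"
      using FR sR by (simp add: insert_commute del: insert_Times_insert)
  qed
  ultimately show ?thesis by metis
qed

text \<open>With \<open>zs\<close> shrunk to a triangle and each leg to an edge, two triangles
  joined by a matching remain. The legs are restored one at a time; the other legs, restored or
  still single edges, belong to \<open>F\<close> meanwhile.\<close>

lemma iso_to_subdivision_prism_triangle:
  assumes zs: "distinct zs" "{p, q, r} \<subseteq> set zs" "p \<noteq> q" "q \<noteq> r" "p \<noteq> r"
    and B: "distinct (as @ [a] @ bs @ [b] @ cs @ [c])"
      "set (as @ [a] @ bs @ [b] @ cs @ [c]) \<inter> set zs = {}"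
  shows "iso_to_subdivision (ugraph (cedges zs \<union> (pedges (p # as @ [a]) \<union> pedges (q # bs @ [b]) \<union>
    pedges (r # cs @ [c]) \<union> {(a, b), (b, c), (c, a)}))) prism"
proof -
  let ?D = "{(a, b), (b, c), (c, a)}"
  let ?F = "pedges (p # as @ [a]) \<union> pedges (q # bs @ [b]) \<union> pedges (r # cs @ [c]) \<union> ?D"
  have path: "(u, v) \<notin> pedges (x # ys)" if "x \<in> {p, q, r}" "v \<in> {p, q, r}"
    "set ys \<inter> set zs = {}" for x ys u v
    using that pedgesD[of u v "x # ys"] zs by auto
  have pa: "set (as @ [a]) \<inter> set zs = {}" "set (bs @ [b]) \<inter> set zs = {}"
    "set (cs @ [c]) \<inter> set zs = {}" using B by auto
  have D: "a \<notin> {p, q, r}" "b \<notin> {p, q, r}" "c \<notin> {p, q, r}" using B zs by auto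
  have "?F \<inter> {p, q, r} \<times> {p, q, r} = {}"
    using path[of p _ "as @ [a]"] path[of q _ "bs @ [b]"] path[of r _ "cs @ [c]"] pa D
    by blast
  moreover have "Field ?F \<subseteq> {p, q, r} \<union> set (as @ [a] @ bs @ [b] @ cs @ [c])"
    using Field_pedges_subset[of "p # as @ [a]"] Field_pedges_subset[of "q # bs @ [b]"]
      Field_pedges_subset[of "r # cs @ [c]"]
    by (simp only: Field_Un Field_insert Field_empty set_append set_simps Un_insert_right) blast
  then have "Field ?F \<inter> set zs \<subseteq> {p, q, r}" using B(2) by blast
  moreover have "card {p, q, r} \<ge> 3" using zs by simp
  moreover have "finite ?F" by simp
  ultimately have "\<exists>ts. distinct ts \<and> set ts = {p, q, r} \<and>
      (\<forall>P. iso_to_subdivision (ugraph (cedges ts \<union> ?F)) P \<longrightarrow>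
         iso_to_subdivision (ugraph (cedges zs \<union> ?F)) P)"
    using zs(1,2) by (intro iso_to_subdivision_suppress_cycle)
  then obtain ts where ts: "distinct ts" "set ts = {p, q, r}"
    "\<forall>P. iso_to_subdivision (ugraph (cedges ts \<union> ?F)) P \<longrightarrow>
         iso_to_subdivision (ugraph (cedges zs \<union> ?F)) P" by blast
  have dist: "distinct [p, q, r, a, b, c]" using B zs by auto
  let ?Z = "{(p, q), (q, r), (r, p)}"
  have 0: "iso_to_subdivision (ugraph (insert (p, a) (?Z \<union> ?D \<union> {(q, b), (r, c)}))) prism"
    using iso_to_subdivision_prism_base[OF dist] by (simp add: insert_commute)
  have 1: "iso_to_subdivision (ugraph (pedges (p # as @ [a]) \<union> (?Z \<union> ?D \<union> {(q, b), (r, c)}))) prism"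
    using B zs dist by (intro iso_to_subdivision_suppress_path[OF _ _ _ _ _ _ _ 0])
      (auto simp: in_symcl_iff)
  let ?A = "pedges (p # as @ [a])"
  have 2: "iso_to_subdivision (ugraph (insert (q, b) (?Z \<union> ?D \<union> {(r, c)} \<union> ?A))) prism"
    using 1 by (simp add: insert_commute Un_commute)
  have FA: "Field ?A \<subseteq> insert p (set (as @ [a]))" using Field_pedges_subset[of "p # as @ [a]"] by auto
  have 3: "iso_to_subdivision (ugraph (pedges (q # bs @ [b]) \<union> (?Z \<union> ?D \<union> {(r, c)} \<union> ?A))) prism"
  proof (intro iso_to_subdivision_suppress_path[OF _ _ _ _ _ _ _ 2])
    show "set bs \<inter> Field (?Z \<union> ?D \<union> {(r, c)} \<union> ?A) = {}" using FA B zs by auto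
    have "q \<notin> Field ?A" using FA B zs by auto
    then have "(q, b) \<notin> symcl ?A" by (rule notin_symclI)
    then show "(q, b) \<notin> symcl (?Z \<union> ?D \<union> {(r, c)} \<union> ?A)"
      using dist by (auto simp: in_symcl_iff)
  qed (use B zs in auto)
  let ?B = "pedges (q # bs @ [b])"
  have 4: "iso_to_subdivision (ugraph (insert (r, c) (?Z \<union> ?D \<union> ?A \<union> ?B))) prism"
    using 3 by (simp add: insert_commute Un_ac)
  have FB: "Field ?B \<subseteq> insert q (set (bs @ [b]))" using Field_pedges_subset[of "q # bs @ [b]"] by auto
  have 5: "iso_to_subdivision (ugraph (pedges (r # cs @ [c]) \<union> (?Z \<union> ?D \<union> ?A \<union> ?B))) prism"
  proof (intro iso_to_subdivision_suppress_path[OF _ _ _ _ _ _ _ 4])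
    show "set cs \<inter> Field (?Z \<union> ?D \<union> ?A \<union> ?B) = {}" using FA FB B zs by auto
    have "r \<notin> Field ?A" "r \<notin> Field ?B" using FA FB B zs by auto
    then have "(r, c) \<notin> symcl ?A" "(r, c) \<notin> symcl ?B" by (simp_all add: notin_symclI)
    then show "(r, c) \<notin> symcl (?Z \<union> ?D \<union> ?A \<union> ?B)"
      using dist by (auto simp: in_symcl_iff)
  qed (use B zs in auto)
  have "symcl (cedges ts \<union> ?F) = symcl (pedges (r # cs @ [c]) \<union> (?Z \<union> ?D \<union> ?A \<union> ?B))"
    using symcl_cedges_triple[OF ts(1,2)] zs by (simp only: symcl_Un) blast
  then have "ugraph (cedges ts \<union> ?F) = ugraph (pedges (r # cs @ [c]) \<union> (?Z \<union> ?D \<union> ?A \<union> ?B))"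
    by (rule ugraph_cong)
  then show ?thesis using 5 ts(3) by simp
qed

text \<open>After suppression \<open>zs\<close> is a four-cycle and \<open>b\<close>,
  \<open>b'\<close> are adjacent. If \<open>s\<close>, \<open>t\<close> are consecutive on it, the
  triangles on \<open>b\<close>, \<open>s\<close>, \<open>t\<close> and on \<open>b'\<close>,
  \<open>u\<close>, \<open>v\<close> form a prism; if they are opposite, the graph is
  \<open>K_{3,3}\<close> with parts \<open>{b, u, v}\<close> and \<open>{b', s, t}\<close>.\<close>

lemma iso_to_subdivision_two_forks:
  assumes zs: "distinct zs" "distinct [s, t, u, v]" "{s, t, u, v} \<subseteq> set zs"
    and B: "distinct (b # ws @ [b'])" "set (b # ws @ [b']) \<inter> set zs = {}"
  defines "H \<equiv> ugraph (cedges zs \<union> (pedges (b # ws @ [b']) \<union> {b} \<times> {s, t} \<union> {b'} \<times> {u, v}))"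
  shows "iso_to_subdivision H prism \<or> (\<exists>K :: nat pair_pre_digraph.
     complete_bipartite_digraph 3 3 (with_proj K) \<and> iso_to_subdivision H K)"
proof -
  let ?D = "{b} \<times> {s, t} \<union> {b'} \<times> {u, v}"
  let ?F = "pedges (b # ws @ [b']) \<union> ?D"
  let ?T = "{s, t, u, v}"
  have FP: "Field (pedges (b # ws @ [b'])) \<subseteq> set (b # ws @ [b'])"
    by (rule Field_pedges_subset)
  have "pedges (b # ws @ [b']) \<inter> ?T \<times> ?T = {}"
    using FP B zs by (fastforce simp: Field_def)
  moreover have "?D \<inter> ?T \<times> ?T = {}" using B zs by auto
  ultimately have "?F \<inter> ?T \<times> ?T = {}" by blast
  moreover have "Field ?F \<inter> set zs \<subseteq> ?T"
    using FP B by (fastforce simp: Field_def)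
  moreover have "card ?T \<ge> 3" using zs by simp
  moreover have "finite ?F" by simp
  ultimately have "\<exists>ts. distinct ts \<and> set ts = ?T \<and>
      (\<forall>P. iso_to_subdivision (ugraph (cedges ts \<union> ?F)) P \<longrightarrow>
         iso_to_subdivision (ugraph (cedges zs \<union> ?F)) P)"
    using zs(1,3) by (intro iso_to_subdivision_suppress_cycle)
  then obtain ts where ts: "distinct ts" "set ts = ?T"
    "\<And>P. iso_to_subdivision (ugraph (cedges ts \<union> ?F)) P \<Longrightarrow> iso_to_subdivision H P"
    unfolding H_def Un_assoc by blast
  have dist: "distinct [s, t, u, v, b, b']" using B zs by auto
  obtain xs ys where xy: "ts = xs @ s # ys" using ts by (metis insertI1 split_list)
  have ce: "cedges ts = cedges (s # ys @ xs)" unfolding xy using cedges_rotate[of xs "s # ys"] by simp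
  have ys: "distinct (ys @ xs)" "set (ys @ xs) = {t, u, v}"
  proof -
    show "distinct (ys @ xs)" using ts xy by auto
    have "s \<notin> set (ys @ xs)" using ts(1) xy by auto
    then have "set (ys @ xs) = set ts - {s}" unfolding xy by auto
    then show "set (ys @ xs) = {t, u, v}" unfolding ts(2) using dist by auto
  qed
  have "length (ys @ xs) = 3" using ys dist distinct_card[of "ys @ xs"] by simp
  then obtain x y z where xyz: "ys @ xs = [x, y, z]"
    unfolding numeral_3_eq_3 length_Suc_conv by auto
  have ce: "cedges ts = {(z, s), (s, x), (x, y), (y, z)}"
    unfolding ce xyz by (auto simp: cedges_def)
  have red: "iso_to_subdivision H P"
    if "iso_to_subdivision (ugraph (insert (b, b') (cedges ts \<union> ?D))) P" for P
  proof -
    have Fc: "Field (cedges ts) = ?T" 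
      unfolding ce using ys dist xyz by (auto simp: Field_def)
    have "iso_to_subdivision (ugraph (pedges (b # ws @ [b']) \<union> (cedges ts \<union> ?D))) P"
    proof (intro iso_to_subdivision_suppress_path[OF _ _ _ _ _ _ _ that])
      show "set ws \<inter> Field (cedges ts \<union> ?D) = {}" using Fc B zs by (auto simp: Field_def)
      have "b \<notin> Field (cedges ts)" using Fc dist by auto
      then have "(b, b') \<notin> symcl (cedges ts)" by (rule notin_symclI)
      then show "(b, b') \<notin> symcl (cedges ts \<union> ?D)"
        using dist by (auto simp: in_symcl_iff)
    qed (use B in \<open>auto simp: ce\<close>)
    then show ?thesis using ts(3) by (simp add: Un_ac)
  qed
  have D: "?D = {(b, s), (b, t), (b', u), (b', v)}" by blast
  have sx: "{x, y, z} = {t, u, v}" "distinct [x, y, z]" using ys xyz by simp_all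
  have t: "t \<notin> {u, v}" using dist by simp
  have "t \<in> {x, y, z}" unfolding sx(1) by simp
  \<comment> \<open>The four-cycle reads \<open>s\<close>, \<open>x\<close>, \<open>y\<close>,
    \<open>z\<close>, so \<open>t\<close> follows, precedes or faces \<open>s\<close>.\<close>
  then consider "x = t" | "z = t" | "y = t" by auto
  then show ?thesis
  proof cases
    case 1
    have "{y, z} = {u, v}" using sx t insert_ident[of t "{y, z}" "{u, v}"] by (simp add: 1)
    then have yz: "y = u \<and> z = v \<or> y = v \<and> z = u" by (simp add: doubleton_eq_iff)
    then have dist': "distinct [b, s, t, b', z, y]" using dist by auto
    have "symcl (insert (b, b') (cedges ts \<union> ?D)) = symcl ({(b, s), (s, t), (t, b)} \<union>
        {(b', z), (z, y), (y, b')} \<union> {(b, b'), (s, z), (t, y)})"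
      unfolding ce D using yz by (elim disjE) (simp_all add: 1 symcl_def insert_commute)
    then have "ugraph (insert (b, b') (cedges ts \<union> ?D)) = ugraph ({(b, s), (s, t), (t, b)} \<union>
        {(b', z), (z, y), (y, b')} \<union> {(b, b'), (s, z), (t, y)})" by (rule ugraph_cong)
    then show ?thesis using red iso_to_subdivision_prism_base[OF dist'] by metis
  next
    case 2
    have "insert t {x, y} = {x, y, z}" by (simp add: 2 insert_commute)
    also have "\<dots> = insert t {u, v}" by (rule sx(1))
    finally have "insert t {x, y} = insert t {u, v}" .
    then have "{x, y} = {u, v}" using sx(2) t insert_ident[of t "{x, y}" "{u, v}"] by (auto simp: 2)
    then have xy: "x = u \<and> y = v \<or> x = v \<and> y = u" by (simp add: doubleton_eq_iff)
    then have dist': "distinct [b, s, t, b', x, y]" using dist by auto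
    have "symcl (insert (b, b') (cedges ts \<union> ?D)) = symcl ({(b, s), (s, t), (t, b)} \<union>
        {(b', x), (x, y), (y, b')} \<union> {(b, b'), (s, x), (t, y)})"
      unfolding ce D using xy by (elim disjE) (simp_all add: 2 symcl_def insert_commute)
    then have "ugraph (insert (b, b') (cedges ts \<union> ?D)) = ugraph ({(b, s), (s, t), (t, b)} \<union>
        {(b', x), (x, y), (y, b')} \<union> {(b, b'), (s, x), (t, y)})" by (rule ugraph_cong)
    then show ?thesis using red iso_to_subdivision_prism_base[OF dist'] by metis
  next
    case 3
    have "insert t {x, z} = {x, y, z}" by (simp add: 3 insert_commute)
    also have "\<dots> = insert t {u, v}" by (rule sx(1))
    finally have "insert t {x, z} = insert t {u, v}" .
    then have "{x, z} = {u, v}" using sx(2) t insert_ident[of t "{x, z}" "{u, v}"] by (auto simp: 3)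
    then have xz: "x = u \<and> z = v \<or> x = v \<and> z = u" by (simp add: doubleton_eq_iff)
    then have dist': "distinct [b, x, z, b', s, t]" using dist by auto
    have K: "{b, x, z} \<times> {b', s, t} = {(b, b'), (b, s), (b, t), (x, b'), (x, s), (x, t),
        (z, b'), (z, s), (z, t)}" by blast
    have "symcl (insert (b, b') (cedges ts \<union> ?D)) = symcl ({b, x, z} \<times> {b', s, t})"
      unfolding ce D K using xz by (elim disjE) (simp_all add: 3 symcl_def insert_commute)
    then have "ugraph (insert (b, b') (cedges ts \<union> ?D)) = ugraph ({b, x, z} \<times> {b', s, t})"
      by (rule ugraph_cong)
    then show ?thesis using red iso_to_subdivision_K33_base[OF dist'] by metis
  qed
qed

section \<open>Connected sets and induced paths\<close>

lemma two_elements_split: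
  assumes "a \<in> set xs" "b \<in> set xs" "a \<noteq> b"
  obtains as ms cs where "xs = as @ a # ms @ b # cs" | as ms cs where "xs = as @ b # ms @ a # cs"
proof -
  obtain ys zs where xs: "xs = ys @ a # zs" using assms by (meson split_list)
  consider "b \<in> set ys" | "b \<in> set zs" using assms xs by auto
  then show thesis
  proof cases
    case 1
    then obtain us vs where "ys = us @ b # vs" by (meson split_list)
    then show thesis using that(2) xs by simp
  next
    case 2
    then obtain us vs where "zs = us @ b # vs" by (meson split_list)
    then show thesis using that(1) xs by simp
  qed
qed

locale simple_graph =
  fixes V :: "'a set" and E :: "('a \<times> 'a) set"
  assumes finite_V: "finite V" and E_V: "E \<subseteq> V \<times> V"
    and E_sym: "(a, b) \<in> E \<Longrightarrow> (b, a) \<in> E" and E_irrefl: "(a, a) \<notin> E"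
begin

text \<open>Connectedness by cuts: unions and deletions of sets then need one crossing edge instead
  of concatenated walks. \<open>walk_exists\<close> recovers walks, and
  \<open>conn_iff_connected\<close> relates this to the library's notion.\<close>

definition conn :: "'a set \<Rightarrow> bool" where
  "conn S \<longleftrightarrow> S \<noteq> {} \<and> (\<forall>X\<subseteq>S. X \<noteq> {} \<and> X \<noteq> S \<longrightarrow> (\<exists>a\<in>X. \<exists>b\<in>S - X. (a, b) \<in> E))"

definition nbrs :: "'a set \<Rightarrow> 'a set" where
  "nbrs S = {b. b \<notin> S \<and> (\<exists>a\<in>S. (a, b) \<in> E)}"

definition att :: "'a set \<Rightarrow> 'a set \<Rightarrow> 'a set" where
  "att Z K = {z \<in> Z. \<exists>b\<in>K. (b, z) \<in> E}"

definition component :: "'a set \<Rightarrow> 'a set \<Rightarrow> bool" where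
  "component K U \<longleftrightarrow> K \<subseteq> U \<and> conn K \<and> (\<forall>a\<in>K. \<forall>b\<in>U - K. (a, b) \<notin> E)"

text \<open>The single equation says both that consecutive vertices are adjacent and that there is
  no chord; likewise in \<open>icycle\<close>.\<close>

definition ipath :: "'a list \<Rightarrow> bool" where
  "ipath xs \<longleftrightarrow> xs \<noteq> [] \<and> distinct xs \<and> E \<inter> set xs \<times> set xs = symcl (pedges xs)"

definition icycle :: "'a list \<Rightarrow> bool" where
  "icycle zs \<longleftrightarrow> distinct zs \<and> length zs \<ge> 3 \<and> E \<inter> set zs \<times> set zs = symcl (cedges zs)"

section \<open>Connected sets and components\<close>

lemma connD:
  assumes "conn S" "X \<subseteq> S" "x \<in> X" "y \<in> S" "y \<notin> X"
  obtains a b where "a \<in> X" "b \<in> S" "b \<notin> X" "(a, b) \<in> E"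
  using assms unfolding conn_def by blast

lemma conn_nonempty: "conn S \<Longrightarrow> S \<noteq> {}"
  by (simp add: conn_def)

lemma conn_singleton [simp]: "conn {v}"
  by (auto simp: conn_def)

text \<open>A cut crossed by no edge can split neither \<open>A\<close> nor \<open>B\<close>, so it
  would have to separate them, which a common vertex or an edge between them forbids.\<close>

lemma conn_Un:
  assumes A: "conn A" and B: "conn B" and AB: "A \<inter> B \<noteq> {} \<or> (\<exists>a\<in>A. \<exists>b\<in>B. (a, b) \<in> E)"
  shows "conn (A \<union> B)"
  unfolding conn_def
proof (intro conjI allI impI)
  show "A \<union> B \<noteq> {}" using A conn_nonempty by blast
  fix X assume X: "X \<subseteq> A \<union> B" "X \<noteq> {} \<and> X \<noteq> A \<union> B"
  show "\<exists>a\<in>X. \<exists>b\<in>A \<union> B - X. (a, b) \<in> E"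
  proof (rule ccontr)
    assume "\<not> ?thesis"
    then have no: "(a, b) \<notin> E" if "a \<in> X" "b \<in> A \<union> B" "b \<notin> X" for a b using that by blast
    have "X \<inter> A = {} \<or> A \<subseteq> X" using connD[OF A, of "X \<inter> A"] no by blast
    moreover have "X \<inter> B = {} \<or> B \<subseteq> X" using connD[OF B, of "X \<inter> B"] no by blast
    ultimately consider "A \<subseteq> X" "X \<inter> B = {}" | "B \<subseteq> X" "X \<inter> A = {}" using X by blast
    then show False using AB no E_sym conn_nonempty[OF A] conn_nonempty[OF B] by cases blast+
  qed
qed

lemma conn_insert:
  assumes "conn A" "a \<in> A" "(a, b) \<in> E"
  shows "conn (insert b A)"
  using conn_Un[OF assms(1) conn_singleton[of b]] assms by auto

lemma conn_walk: "xs \<noteq> [] \<Longrightarrow> pedges xs \<subseteq> E \<Longrightarrow> conn (set xs)"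
proof (induction xs)
  case (Cons a xs)
  show ?case
  proof (cases "xs = []")
    case False
    then have "(hd xs, a) \<in> E" "pedges xs \<subseteq> E" using Cons.prems E_sym by (auto simp: pedges_Cons)
    then show ?thesis using Cons.IH[OF False] False conn_insert[of "set xs" "hd xs" a] by simp
  qed simp
qed simp

lemma component_exists:
  assumes "conn X" "X \<subseteq> U" "finite U"
  obtains K where "X \<subseteq> K" "component K U"
proof -
  let ?P = "\<lambda>K. X \<subseteq> K \<and> K \<subseteq> U \<and> conn K"
  have "?P X" using assms by blast
  moreover have "\<forall>K. ?P K \<longrightarrow> card K < Suc (card U)"
    using assms(3) by (simp add: card_mono less_Suc_eq_le)
  ultimately obtain K where K: "?P K" "\<And>L. ?P L \<Longrightarrow> card L \<le> card K"
    using ex_has_greatest_nat[of ?P X card "Suc (card U)"] by blast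
  have "(a, b) \<notin> E" if "a \<in> K" "b \<in> U" "b \<notin> K" for a b
  proof
    assume "(a, b) \<in> E"
    then have "?P (insert b K)" using K(1) that conn_insert by blast
    then have "card (insert b K) \<le> card K" by (rule K(2))
    moreover have "finite K" using K(1) assms(3) finite_subset by blast
    ultimately show False using that by simp
  qed
  then have "component K U" using K(1) by (simp add: component_def)
  with K(1) that show thesis by blast
qed

lemma componentD:
  assumes "component K U"
  shows "K \<subseteq> U" "conn K" "\<And>a b. a \<in> K \<Longrightarrow> b \<in> U \<Longrightarrow> b \<notin> K \<Longrightarrow> (a, b) \<notin> E"
  using assms by (auto simp: component_def)

lemma component_absorb:
  assumes "component K U" "conn Y" "Y \<subseteq> U" "Y \<inter> K \<noteq> {}"
  shows "Y \<subseteq> K"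
proof (rule ccontr)
  assume "\<not> Y \<subseteq> K"
  then obtain x y where "x \<in> Y \<inter> K" "y \<in> Y" "y \<notin> Y \<inter> K" using assms(4) by blast
  then obtain a b where "a \<in> Y \<inter> K" "b \<in> Y" "b \<notin> Y \<inter> K" "(a, b) \<in> E"
    by (rule connD[OF assms(2) Int_lower1])
  then show False using componentD(3)[OF assms(1), of a b] assms(3) by blast
qed

text \<open>Within \<open>B\<close> the component \<open>K\<close> is adjacent to \<open>v\<close>
  only. Hence an edge that leaves a set avoiding \<open>K\<close> and \<open>v\<close> cannot end in
  \<open>K\<close>; for a cut containing \<open>v\<close> the other side is taken.\<close>

lemma conn_remove_component:
  assumes B: "conn B" "v \<in> B" and comp: "component K (B - {v})"
  shows "conn (B - K)"
  unfolding conn_def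
proof (intro conjI allI impI)
  note K = componentD(1,3)[OF comp]
  show "B - K \<noteq> {}" using B K by blast
  fix X assume X: "X \<subseteq> B - K" "X \<noteq> {} \<and> X \<noteq> B - K"
  have *: "\<exists>a\<in>Y. \<exists>b\<in>B - K - Y. (a, b) \<in> E" if Y: "Y \<subseteq> B - K" "y \<in> Y" "v \<notin> Y" for Y y
  proof -
    obtain a b where "a \<in> Y" "b \<in> B" "b \<notin> Y" "(a, b) \<in> E"
      using connD[OF B(1), of Y y v] Y B by blast
    moreover have "b \<notin> K" using K(2)[of b a] E_sym calculation Y by blast
    ultimately show ?thesis by blast
  qed
  show "\<exists>a\<in>X. \<exists>b\<in>B - K - X. (a, b) \<in> E"
  proof (cases "v \<in> X")
    case True
    obtain y where "y \<in> B - K - X" using X by blast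
    then obtain a b where "a \<in> B - K - X" "b \<in> B - K - (B - K - X)" "(a, b) \<in> E"
      using *[of "B - K - X" y] True by blast
    then show ?thesis using E_sym by blast
  next
    case False
    then show ?thesis using * X by blast
  qed
qed

section \<open>Walks and shortest paths\<close>

lemma walk_exists:
  assumes S: "conn S" and a: "a \<in> S" and b: "b \<in> S"
  obtains xs where "xs \<noteq> []" "pedges xs \<subseteq> E" "set xs \<subseteq> S" "hd xs = a" "last xs = b"
proof -
  let ?P = "\<lambda>y xs. xs \<noteq> [] \<and> pedges xs \<subseteq> E \<and> set xs \<subseteq> S \<and> hd xs = a \<and> last xs = y"
  let ?X = "{y \<in> S. \<exists>xs. ?P y xs}"
  have "?P a [a]" using a by simp
  then have "a \<in> ?X" using a by blast
  have "b \<in> ?X"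
  proof (rule ccontr)
    assume "b \<notin> ?X"
    then obtain c d where "c \<in> ?X" and d: "d \<in> S" "d \<notin> ?X" "(c, d) \<in> E"
      using connD[OF S _ \<open>a \<in> ?X\<close> b] by blast
    then obtain xs where "?P c xs" by blast
    then have "?P d (xs @ [d])" using d by (auto simp: pedges_append)
    then show False using d by blast
  qed
  then show thesis using that by blast
qed

lemma pedges_shortcut:
  assumes "pedges (as @ a # ms @ b # cs) \<subseteq> E" "(a, b) \<in> E"
  shows "pedges (as @ a # b # cs) \<subseteq> E"
proof -
  have "pedges (as @ [a]) \<subseteq> E"
    using assms(1) pedges_append[of "as @ [a]" "ms @ b # cs"] by auto
  moreover have "pedges (b # cs) \<subseteq> E"
    using assms(1) pedges_append[of "as @ a # ms" "b # cs"] by auto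
  ultimately show ?thesis using assms(2) pedges_append[of "as @ [a]" "b # cs"] by auto
qed

text \<open>Minimal length yields everything at once: a repeated vertex, a chord, or a further
  vertex in \<open>P\<close> or \<open>Q\<close> would allow a shorter walk. If a vertex of
  \<open>S\<close> lies in both \<open>P\<close> and \<open>Q\<close>, the path found is a single
  vertex.\<close>

lemma shortest_path_exists:
  assumes S: "conn S" and P: "a \<in> S" "a \<in> P" and Q: "b \<in> S" "b \<in> Q"
  obtains xs where "ipath xs" "set xs \<subseteq> S"
    "set xs \<inter> P = {hd xs}" "set xs \<inter> Q = {last xs}"
proof -
  let ?W = "\<lambda>xs. xs \<noteq> [] \<and> pedges xs \<subseteq> E \<and> set xs \<subseteq> S \<and> hd xs \<in> P \<and> last xs \<in> Q"
  obtain xs0 where "?W xs0" using walk_exists[OF S P(1) Q(1)] P Q by metis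
  then obtain xs where xs: "?W xs" and min: "\<And>ys. ?W ys \<Longrightarrow> length xs \<le> length ys"
    using ex_has_least_nat[of ?W xs0 length] by blast
  have dist: "distinct xs"
  proof (rule ccontr)
    assume "\<not> distinct xs"
    then obtain as y ms cs where d: "xs = as @ [y] @ ms @ [y] @ cs"
      using not_distinct_decomp by blast
    have "pedges (as @ y # cs) \<subseteq> E"
    proof -
      have "pedges (as @ [y]) \<subseteq> E"
        using xs d pedges_append[of "as @ [y]" "ms @ [y] @ cs"] by auto
      moreover have "pedges (y # cs) \<subseteq> E"
        using xs d pedges_append[of "as @ y # ms" "y # cs"] by auto
      ultimately show ?thesis by (cases "as = []") (auto simp: pedges_append)
    qed
    then have "?W (as @ y # cs)" using xs d by (cases as; cases cs) auto
    from min[OF this] show False using d by simp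
  qed
  have edge: "(a, b) \<in> pedges xs"
    if ab: "(a, b) \<in> E" and split: "xs = as @ a # ms @ b # cs" for a b as ms cs
  proof (cases "ms = []")
    case True
    then show ?thesis using split by (cases "as = []") (auto simp: pedges_append)
  next
    case False
    have "pedges (as @ a # b # cs) \<subseteq> E" using pedges_shortcut xs split ab by blast
    then have "?W (as @ a # b # cs)" using xs split by (cases as; cases cs) auto
    from min[OF this] show ?thesis using split False by simp
  qed
  have "E \<inter> set xs \<times> set xs = symcl (pedges xs)"
  proof (intro equalityI subrelI)
    fix a b assume "(a, b) \<in> E \<inter> set xs \<times> set xs"
    then have ab: "(a, b) \<in> E" "a \<in> set xs" "b \<in> set xs" by auto
    then have "a \<noteq> b" using E_irrefl by auto
    with ab(2,3) show "(a, b) \<in> symcl (pedges xs)"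
      by (cases rule: two_elements_split) (use edge ab(1) E_sym in \<open>auto simp: in_symcl_iff\<close>)
  next
    fix a b assume "(a, b) \<in> symcl (pedges xs)"
    then show "(a, b) \<in> E \<inter> set xs \<times> set xs"
      using xs E_sym[of b a] pedgesD[of a b xs] pedgesD2[of a b xs]
        pedgesD[of b a xs] pedgesD2[of b a xs]
      by (auto simp: in_symcl_iff)
  qed
  then have "ipath xs" using xs dist by (simp add: ipath_def)
  moreover have "y = hd xs" if y: "y \<in> set xs" "y \<in> P" for y
  proof -
    obtain as bs where s: "xs = as @ y # bs" using y by (meson split_list)
    have "pedges (y # bs) \<subseteq> E" using xs s by (cases "as = []") (auto simp: pedges_append)
    then have "?W (y # bs)" using xs s y by auto
    from min[OF this] show ?thesis using s by simp
  qed
  moreover have "y = last xs" if y: "y \<in> set xs" "y \<in> Q" for y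
  proof -
    obtain as bs where s: "xs = as @ y # bs" using y by (meson split_list)
    have "pedges (as @ [y]) \<subseteq> E"
      using xs s pedges_append[of "as @ [y]" bs] by (cases "bs = []") auto
    then have "?W (as @ [y])" using xs s y by (cases as) auto
    from min[OF this] show ?thesis using s by simp
  qed
  moreover have "hd xs \<in> set xs" "last xs \<in> set xs" using xs by auto
  ultimately show thesis using xs by (intro that[of xs]) blast+
qed

end

section \<open>Minimal connected attachments to an induced cycle\<close>

definition wheel_prism_K33 :: "'a pair_pre_digraph \<Rightarrow> bool" where
  "wheel_prism_K33 H \<longleftrightarrow> (\<exists>l \<ge> 3. iso_to_subdivision H (wheel l)) \<or>
     iso_to_subdivision H prism \<or>
     (\<exists>K :: nat pair_pre_digraph.
        complete_bipartite_digraph 3 3 (with_proj K) \<and> iso_to_subdivision H K)"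

lemma symcl_symcl [simp]: "symcl (symcl X) = symcl X"
  by (auto simp: in_symcl_iff)

lemma ugraph_symcl [simp]: "ugraph (symcl X) = ugraph X"
  by (rule ugraph_cong) simp

context simple_graph
begin

lemma induced_Un:
  assumes "E \<inter> A \<times> A = symcl C" "E \<inter> B \<times> B = symcl D" "X \<subseteq> A \<times> B \<union> B \<times> A"
    and "\<And>a b. a \<in> A \<Longrightarrow> b \<in> B \<Longrightarrow> (a, b) \<in> E \<longleftrightarrow> (a, b) \<in> symcl X"
  shows "E \<inter> (A \<union> B) \<times> (A \<union> B) = symcl (C \<union> (D \<union> X))"
proof -
  have 1: "E \<inter> A \<times> B = symcl X \<inter> A \<times> B" using assms(4) by blast
  have 2: "E \<inter> B \<times> A = symcl X \<inter> B \<times> A"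
    using assms(4) E_sym in_symcl_iff[of _ _ X] by blast
  have 3: "symcl X \<subseteq> A \<times> B \<union> B \<times> A" using assms(3) by (auto simp: in_symcl_iff)
  have "E \<inter> (A \<union> B) \<times> (A \<union> B) = E \<inter> A \<times> A \<union> E \<inter> B \<times> B \<union> (E \<inter> A \<times> B \<union> E \<inter> B \<times> A)"
    by blast
  also have "\<dots> = symcl C \<union> symcl D \<union> symcl X" unfolding 1 2 assms(1,2) using 3 by blast
  finally show ?thesis by (simp add: symcl_Un Un_assoc)
qed

lemma ipath_edges: "ipath xs \<Longrightarrow> pedges xs \<subseteq> E"
  by (auto simp: ipath_def symcl_def)

lemma ipath_rev: "ipath xs \<Longrightarrow> ipath (rev xs)"
  by (simp add: ipath_def pedges_rev)

lemma ipath_append: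
  assumes xs: "ipath xs" and ys: "ipath ys" and disj: "set xs \<inter> set ys = {}"
    and edge: "\<And>x y. x \<in> set xs \<Longrightarrow> y \<in> set ys \<Longrightarrow> (x, y) \<in> E \<longleftrightarrow> x = last xs \<and> y = hd ys"
  shows "ipath (xs @ ys)"
proof -
  have ne: "xs \<noteq> []" "ys \<noteq> []" using xs ys by (auto simp: ipath_def)
  have hl: "last xs \<in> set xs" "hd ys \<in> set ys" using ne by auto
  have "E \<inter> (set xs \<union> set ys) \<times> (set xs \<union> set ys)
      = symcl (pedges xs \<union> (pedges ys \<union> {(last xs, hd ys)}))"
  proof (rule induced_Un)
    show "E \<inter> set xs \<times> set xs = symcl (pedges xs)" "E \<inter> set ys \<times> set ys = symcl (pedges ys)"
      using xs ys by (simp_all add: ipath_def)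
    show "{(last xs, hd ys)} \<subseteq> set xs \<times> set ys \<union> set ys \<times> set xs" using hl by simp
    show "(a, b) \<in> E \<longleftrightarrow> (a, b) \<in> symcl {(last xs, hd ys)}" if "a \<in> set xs" "b \<in> set ys" for a b
      using edge[OF that] that hl disj by (auto simp: in_symcl_iff)
  qed
  then show ?thesis
    using xs ys disj ne by (simp add: ipath_def pedges_append insert_commute Un_insert_right)
qed

lemma att_mono: "K \<subseteq> L \<Longrightarrow> att Z K \<subseteq> att Z L"
  by (auto simp: att_def)

end

text \<open>What is kept of the extremal choice is inclusion-minimality among connected sets with
  three attachments. The shape of \<open>B\<close> follows from this in any simple graph.\<close>

locale minimal_attachment = simple_graph V E for V :: "'a set" and E +
  fixes zs :: "'a list" and B :: "'a set"
  assumes cycle: "icycle zs" and B_V: "B \<subseteq> V" and conn_B: "conn B"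
    and disj: "B \<inter> set zs = {}" and att_B: "card (att (set zs) B) \<ge> 3"
    and minimal: "\<And>K. conn K \<Longrightarrow> K \<subset> B \<Longrightarrow> card (att (set zs) K) \<le> 2"
begin

lemma distinct_zs: "distinct zs" and length_zs: "length zs \<ge> 3"
  and edges_zs: "E \<inter> set zs \<times> set zs = symcl (cedges zs)"
  using cycle by (simp_all add: icycle_def)

lemma finite_att [simp]: "finite (att (set zs) K)"
  by (simp add: att_def)

lemma eq_B:
  assumes "conn K" "K \<subseteq> B" "{p, q, r} \<subseteq> att (set zs) K" "p \<noteq> q" "q \<noteq> r" "p \<noteq> r"
  shows "K = B"
proof (rule ccontr)
  assume "K \<noteq> B"
  then have "card (att (set zs) K) \<le> 2" using minimal assms by blast
  moreover have "card {p, q, r} \<le> card (att (set zs) K)"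
    by (rule card_mono) (use assms in auto)
  ultimately show False using assms by simp
qed

lemma induced_ugraph:
  assumes "E \<inter> B \<times> B = symcl D" "X \<subseteq> set zs \<times> B \<union> B \<times> set zs"
    and "\<And>z b. z \<in> set zs \<Longrightarrow> b \<in> B \<Longrightarrow> (z, b) \<in> E \<longleftrightarrow> (z, b) \<in> symcl X"
  shows "ugraph (E \<inter> (set zs \<union> B) \<times> (set zs \<union> B)) = ugraph (cedges zs \<union> (D \<union> X))"
  using induced_Un[OF edges_zs assms] by simp

section \<open>The possible shapes of \<open>B\<close>: vertex, path, fork\<close>

lemma single_vertex:
  assumes "B = {h}"
  shows "wheel_prism_K33 (ugraph (E \<inter> (set zs \<union> B) \<times> (set zs \<union> B)))"
proof -
  let ?N = "att (set zs) B"
  have "ugraph (E \<inter> (set zs \<union> B) \<times> (set zs \<union> B)) = ugraph (cedges zs \<union> ({} \<union> {h} \<times> ?N))"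
  proof (rule induced_ugraph)
    show "E \<inter> B \<times> B = symcl {}" using E_irrefl assms by (auto simp: symcl_def)
    show "(z, b) \<in> E \<longleftrightarrow> (z, b) \<in> symcl ({h} \<times> ?N)" if "z \<in> set zs" "b \<in> B" for z b
      using that assms disj E_sym by (auto simp: in_symcl_iff att_def)
  qed (auto simp: assms att_def)
  moreover have "\<exists>l\<ge>3. iso_to_subdivision (ugraph (cedges zs \<union> {h} \<times> ?N)) (wheel l)"
    using disj assms att_B
    by (intro iso_to_subdivision_wheel_hub distinct_zs) (auto simp: att_def)
  ultimately show ?thesis by (simp add: wheel_prism_K33_def)
qed

text \<open>Deleting either end of the path leaves a connected proper subset with at most two
  attachments, and every attachment survives one of these deletions; so there are three or four.
  With three, some \<open>p\<close> sees only \<open>b\<close>, some \<open>q\<close> sees only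
  \<open>b'\<close>, and the third vertex \<open>r\<close> becomes the hub of a wheel. With four,
  the two pairs are disjoint: one pair sees only \<open>b\<close>, the other only \<open>b'\<close>,
  and inner vertices see nothing.\<close>

lemma path_attachment:
  assumes bs: "ipath bs" "set bs = B" and len: "length bs \<ge> 2"
  shows "wheel_prism_K33 (ugraph (E \<inter> (set zs \<union> B) \<times> (set zs \<union> B)))"
proof -
  obtain b ws b' where w: "bs = b # ws @ [b']"
  proof -
    obtain b bs' where 1: "bs = b # bs'" "bs' \<noteq> []" using len by (cases bs; cases "tl bs") auto
    then have "bs = b # butlast bs' @ [last bs']" by simp
    then show thesis by (rule that)
  qed
  have eb: "E \<inter> B \<times> B = symcl (pedges bs)" using bs by (auto simp: ipath_def)
  have dist: "distinct (b # ws @ [b'])" using bs(1) unfolding w ipath_def by blast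
  have pe: "pedges (b # ws @ [b']) \<subseteq> E" using ipath_edges[OF bs(1)] w by simp
  have bB: "b \<in> B" "b' \<in> B" "b \<noteq> b'" using bs w dist by auto
  let ?M = "\<lambda>c. att (set zs) (B - {c})"
  have M: "card (?M b) \<le> 2" "card (?M b') \<le> 2"
  proof -
    have "conn (set (ws @ [b']))" by (rule conn_walk) (use pe in \<open>auto simp: pedges_Cons\<close>)
    moreover have "set (ws @ [b']) = B - {b}" unfolding bs(2)[symmetric] w using dist by auto
    ultimately show "card (?M b) \<le> 2" using minimal bB by auto
    have "conn (set (b # ws))"
      by (rule conn_walk) (use pe pedges_append[of "b # ws" "[b']"] in auto)
    moreover have "set (b # ws) = B - {b'}" unfolding bs(2)[symmetric] w using dist by auto
    ultimately show "card (?M b') \<le> 2" using minimal bB by auto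
  qed
  have T: "att (set zs) B = ?M b \<union> ?M b'" using bB by (auto simp: att_def)
  have card: "card (?M b) + card (?M b') = card (att (set zs) B) + card (?M b \<inter> ?M b')"
    unfolding T by (rule card_Un_Int) simp_all
  have inM: "z \<in> ?M c \<longleftrightarrow> (\<exists>d\<in>B. d \<noteq> c \<and> (z, d) \<in> E)" if "z \<in> set zs" for z c
    using that E_sym by (auto simp: att_def)
  have MZ: "?M c \<subseteq> set zs" for c by (auto simp: att_def)
  consider "card (att (set zs) B) = 3" | "card (att (set zs) B) = 4"
    using M card att_B by linarith
  then show ?thesis
  proof cases
    case 1
    obtain p where p: "p \<in> att (set zs) B" "p \<notin> ?M b"
    proof -
      have "\<not> att (set zs) B \<subseteq> ?M b" using card_mono[of "?M b" "att (set zs) B"] 1 M by auto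
      then show thesis using that by blast
    qed
    obtain q where q: "q \<in> att (set zs) B" "q \<notin> ?M b'"
    proof -
      have "\<not> att (set zs) B \<subseteq> ?M b'" using card_mono[of "?M b'" "att (set zs) B"] 1 M by auto
      then show thesis using that by blast
    qed
    have "p \<noteq> q" using p q T by auto
    have "card (att (set zs) B - {p, q}) = 1"
      using 1 p q \<open>p \<noteq> q\<close> by (subst card_Diff_subset) auto
    then obtain r where "att (set zs) B - {p, q} = {r}" by (auto simp: card_1_singleton_iff)
    then have r: "att (set zs) B = {p, q, r}" "r \<noteq> p" "r \<noteq> q" using p q by auto
    have pqr: "{p, q, r} \<subseteq> set zs" using r(1) by (auto simp: att_def)
    let ?N = "{c \<in> B. (c, r) \<in> E}"
    let ?X = "{(p, b), (b', q)} \<union> {r} \<times> ?N"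
    have "ugraph (E \<inter> (set zs \<union> B) \<times> (set zs \<union> B)) = ugraph (cedges zs \<union> (pedges bs \<union> ?X))"
    proof (rule induced_ugraph[OF eb])
      show "?X \<subseteq> set zs \<times> B \<union> B \<times> set zs" using bB pqr by auto
      fix z c assume zc: "z \<in> set zs" "c \<in> B"
      have P: "(p, c) \<in> E \<longleftrightarrow> c = b" if "c \<in> B" for c
        using that p inM[of p b] pqr E_sym by (auto simp: att_def)
      have Q: "(q, c) \<in> E \<longleftrightarrow> c = b'" if "c \<in> B" for c
        using that q inM[of q b'] pqr E_sym by (auto simp: att_def)
      have R: "(r, c) \<in> E \<longleftrightarrow> c \<in> ?N" if "c \<in> B" for c using that E_sym by auto
      have O: "z \<in> {p, q, r}" if "(z, c) \<in> E" using that zc E_sym r(1) by (auto simp: att_def)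
      have ne: "b \<notin> set zs" "b' \<notin> set zs" "c \<notin> set zs" "z \<notin> B" using bB disj zc by auto
      show "(z, c) \<in> E \<longleftrightarrow> (z, c) \<in> symcl ?X"
      proof
        assume "(z, c) \<in> E"
        with O consider "z = p" "c = b" | "z = q" "c = b'" | "z = r" "c \<in> ?N"
          using P[OF zc(2)] Q[OF zc(2)] R[OF zc(2)] by blast
        then show "(z, c) \<in> symcl ?X" by cases (auto simp: in_symcl_iff)
      next
        assume "(z, c) \<in> symcl ?X"
        then have "(z, c) \<in> {(p, b), (q, b')} \<union> {r} \<times> ?N"
          using ne zc pqr by (auto simp: in_symcl_iff)
        then show "(z, c) \<in> E" using P[OF zc(2)] Q[OF zc(2)] R[OF zc(2)] by auto
      qed
    qed
    also have "pedges bs \<union> ?X = pedges (p # bs @ [q]) \<union> {r} \<times> ?N"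
      using pedges_between[of bs p q] w by auto
    finally have "ugraph (E \<inter> (set zs \<union> B) \<times> (set zs \<union> B))
      = ugraph (cedges zs \<union> (pedges (p # bs @ [q]) \<union> {r} \<times> ?N))" .
    moreover have "\<exists>l\<ge>3. iso_to_subdivision
        (ugraph (cedges zs \<union> (pedges (p # bs @ [q]) \<union> {r} \<times> ?N))) (wheel l)"
    proof (rule iso_to_subdivision_wheel_path)
      show "?N \<noteq> {}" using r(1) by (auto simp: att_def)
    qed (use distinct_zs pqr \<open>p \<noteq> q\<close> r bs dist disj w in auto)
    ultimately show ?thesis by (simp add: wheel_prism_K33_def)
  next
    case 2
    then have c2: "card (?M b) = 2" "card (?M b') = 2" "card (?M b \<inter> ?M b') = 0"
      using M card by linarith+
    then have int: "?M b \<inter> ?M b' = {}" by simp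
    obtain u v where uv: "?M b = {u, v}" "u \<noteq> v" using c2(1) by (auto simp: card_2_iff)
    obtain s t where st: "?M b' = {s, t}" "s \<noteq> t" using c2(2) by (auto simp: card_2_iff)
    let ?X = "{b} \<times> {s, t} \<union> {b'} \<times> {u, v}"
    have "ugraph (E \<inter> (set zs \<union> B) \<times> (set zs \<union> B)) = ugraph (cedges zs \<union> (pedges bs \<union> ?X))"
    proof (rule induced_ugraph[OF eb])
      show "?X \<subseteq> set zs \<times> B \<union> B \<times> set zs" using bB uv st MZ by blast
      fix z c assume zc: "z \<in> set zs" "c \<in> B"
      have ne: "b \<notin> set zs" "b' \<notin> set zs" using bB disj by auto
      have "(z, c) \<in> E \<longleftrightarrow> c = b \<and> z \<in> ?M b' \<or> c = b' \<and> z \<in> ?M b"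
      proof
        assume zcE: "(z, c) \<in> E"
        have "z \<in> ?M b" if "c \<noteq> b" using inM[OF zc(1), of b] zcE zc(2) that by metis
        moreover have "z \<in> ?M b'" if "c \<noteq> b'" using inM[OF zc(1), of b'] zcE zc(2) that by metis
        moreover have "\<not> (z \<in> ?M b \<and> z \<in> ?M b')" using int by (metis IntI empty_iff)
        ultimately show "c = b \<and> z \<in> ?M b' \<or> c = b' \<and> z \<in> ?M b" using bB(3) by metis
      next
        have no: "\<not> (z \<in> ?M b \<and> z \<in> ?M b')" using int by (metis IntI empty_iff)
        assume "c = b \<and> z \<in> ?M b' \<or> c = b' \<and> z \<in> ?M b"
        then show "(z, c) \<in> E" using inM[OF zc(1), of b] inM[OF zc(1), of b'] no by metis
      qed
      also have "\<dots> \<longleftrightarrow> (z, c) \<in> symcl ?X"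
        unfolding uv st using ne zc by (auto simp: in_symcl_iff)
      finally show "(z, c) \<in> E \<longleftrightarrow> (z, c) \<in> symcl ?X" .
    qed
    also have "pedges bs \<union> ?X = pedges (b # ws @ [b']) \<union> {b} \<times> {s, t} \<union> {b'} \<times> {u, v}"
      unfolding w by (simp only: Un_assoc)
    finally have "ugraph (E \<inter> (set zs \<union> B) \<times> (set zs \<union> B)) = ugraph (cedges zs \<union>
      (pedges (b # ws @ [b']) \<union> {b} \<times> {s, t} \<union> {b'} \<times> {u, v}))" .
    moreover have "distinct [s, t, u, v]" "{s, t, u, v} \<subseteq> set zs"
      using int uv st MZ[of b] MZ[of b'] by auto
    moreover have "set (b # ws @ [b']) \<inter> set zs = {}" using disj bs w by simp
    ultimately show ?thesis
      using iso_to_subdivision_two_forks[OF distinct_zs _ _ dist, of s t u v]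
      by (simp only: wheel_prism_K33_def simp_thms)
  qed
qed

text \<open>Deleting one leaf keeps the attachments of the other two and, by minimality, no more.
  Since \<open>b\<close> differs from at least two leaves, \<open>z\<close> lies in two of the sets
  \<open>{q, r}\<close>, \<open>{p, r}\<close>, \<open>{p, q}\<close>; if \<open>b\<close> were none
  of the leaves, \<open>z\<close> would lie in all three, whose intersection is empty.\<close>

lemma three_leaves:
  assumes leaf: "conn (B - {x})" "conn (B - {y})" "conn (B - {w})"
    and B: "x \<in> B" "y \<in> B" "w \<in> B" "x \<noteq> y" "y \<noteq> w" "x \<noteq> w"
    and Z: "{p, q, r} \<subseteq> set zs" "p \<noteq> q" "q \<noteq> r" "p \<noteq> r"
    and E: "(x, p) \<in> E" "(y, q) \<in> E" "(w, r) \<in> E"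
    and zb: "z \<in> set zs" "b \<in> B"
  shows "(z, b) \<in> E \<longleftrightarrow> (z, b) \<in> {(p, x), (q, y), (r, w)}"
proof
  have *: "att (set zs) (B - {c}) = {s, t}"
    if "conn (B - {c})" "c \<in> B" "{s, t} \<subseteq> att (set zs) (B - {c})" "s \<noteq> t" for c s t
  proof -
    have "B - {c} \<subset> B" using that(2) by blast
    then have "card (att (set zs) (B - {c})) \<le> card {s, t}"
      using minimal[OF that(1)] that(4) by (simp add: numeral_2_eq_2)
    then show ?thesis using card_seteq[OF finite_att that(3)] by simp
  qed
  have x: "att (set zs) (B - {x}) = {q, r}"
    by (rule *) (use leaf B Z E in \<open>auto simp: att_def\<close>)
  have y: "att (set zs) (B - {y}) = {p, r}"
    by (rule *) (use leaf B Z E in \<open>auto simp: att_def\<close>)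
  have w: "att (set zs) (B - {w}) = {p, q}"
    by (rule *) (use leaf B Z E in \<open>auto simp: att_def\<close>)
  assume zbE: "(z, b) \<in> E"
  have in_att: "z \<in> att (set zs) (B - {c})" if "b \<noteq> c" for c
    using that zbE zb E_sym by (auto simp: att_def)
  show "(z, b) \<in> {(p, x), (q, y), (r, w)}"
    using in_att[of x] in_att[of y] in_att[of w] x y w B Z by auto
next
  assume "(z, b) \<in> {(p, x), (q, y), (r, w)}"
  then show "(z, b) \<in> E" using E E_sym by auto
qed

text \<open>\<open>c\<close> and \<open>d\<close> witness that \<open>rs\<close> still hangs on
  \<open>qs\<close> after either end of \<open>qs\<close> is deleted, so the three ends are leaves
  in the sense of \<open>three_leaves\<close>.\<close>

lemma fork_leaves:
  assumes qs: "ipath qs" and rs: "ipath rs" and QR: "set qs \<inter> set rs = {}" "set qs \<union> set rs = B"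
    and Z: "{p, q, r} \<subseteq> set zs" "p \<noteq> q" "q \<noteq> r" "p \<noteq> r"
    and ends: "(hd qs, p) \<in> E" "(last qs, q) \<in> E" "(hd rs, r) \<in> E"
    and c: "c \<in> set (tl qs)" "(last rs, c) \<in> E" and d: "d \<in> set (butlast qs)" "(last rs, d) \<in> E"
    and zb: "z \<in> set zs" "b \<in> B"
  shows "(z, b) \<in> E \<longleftrightarrow> (z, b) \<in> {(p, hd qs), (q, last qs), (r, hd rs)}"
proof (rule three_leaves[OF _ _ _ _ _ _ _ _ _ Z ends zb])
  have ne: "qs \<noteq> []" "rs \<noteq> []" and dist: "distinct qs" "distinct rs"
    using qs rs by (auto simp: ipath_def)
  have tl: "tl qs \<noteq> []" using c by auto
  have qs_eq: "qs = hd qs # tl qs" "qs = butlast qs @ [last qs]" using ne by auto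
  have hl: "hd qs \<in> set qs" "last qs \<in> set qs" "hd rs \<in> set rs" "last rs \<in> set rs"
    using ne by auto
  show "hd qs \<in> B" "last qs \<in> B" "hd rs \<in> B" "last qs \<noteq> hd rs" "hd qs \<noteq> hd rs"
    using hl QR by auto
  have "hd qs \<notin> set (tl qs)" using dist(1) qs_eq(1) by (metis distinct.simps(2))
  moreover have "last qs \<in> set (tl qs)" using tl last_in_set[OF tl] last_tl by metis
  ultimately show "hd qs \<noteq> last qs" by auto
  have crs: "conn (set rs)" and cqs: "conn (set qs)"
    using conn_walk ipath_edges qs rs ne by auto
  have "conn (set (tl qs))"
    using ipath_edges[OF qs] pedges_Cons[OF tl, of "hd qs"] qs_eq(1) tl
    by (intro conn_walk) auto
  then have "conn (set (tl qs) \<union> set rs)" using crs c hl E_sym by (intro conn_Un) blast+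
  moreover have "set (tl qs) \<union> set rs = B - {hd qs}"
  proof -
    have "set qs = insert (hd qs) (set (tl qs))" using qs_eq(1) by (metis list.simps(15))
    then show ?thesis using \<open>hd qs \<notin> set (tl qs)\<close> QR hl by auto
  qed
  ultimately show "conn (B - {hd qs})" by simp
  have bl: "butlast qs \<noteq> []" using d by auto
  have "conn (set (butlast qs))"
    using ipath_edges[OF qs] pedges_append[OF bl, of "[last qs]"] qs_eq(2) bl
    by (intro conn_walk) auto
  then have "conn (set (butlast qs) \<union> set rs)" using crs d hl E_sym by (intro conn_Un) blast+
  moreover have "set (butlast qs) \<union> set rs = B - {last qs}"
  proof -
    have "set qs = insert (last qs) (set (butlast qs))" "last qs \<notin> set (butlast qs)"
      using arg_cong[OF qs_eq(2), of set] arg_cong[OF qs_eq(2), of distinct] dist(1)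
      by auto
    then show ?thesis using QR hl by auto
  qed
  ultimately show "conn (B - {last qs})" by simp
  show "conn (B - {hd rs})"
  proof (cases "tl rs = []")
    case True
    then have "set rs = {hd rs}" using ne by (cases rs) auto
    then have "B - {hd rs} = set qs" using QR by auto
    then show ?thesis using cqs by simp
  next
    case False
    have rs_eq: "rs = hd rs # tl rs" using ne by simp
    have "conn (set (tl rs))"
      using ipath_edges[OF rs] pedges_Cons[OF False, of "hd rs"] rs_eq False
      by (intro conn_walk) auto
    moreover have "last rs \<in> set (tl rs)" using last_in_set[OF False] last_tl False by metis
    moreover have "c \<in> set qs" using c ne by (simp add: list.set_sel(2))
    ultimately have "conn (set (tl rs) \<union> set qs)" using cqs c by (intro conn_Un) blast+
    moreover have "set (tl rs) \<union> set qs = B - {hd rs}"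
    proof -
      have "set rs = insert (hd rs) (set (tl rs))" "hd rs \<notin> set (tl rs)"
        using arg_cong[OF rs_eq, of set] arg_cong[OF rs_eq, of distinct] dist(2) by auto
      then show ?thesis using QR hl by auto
    qed
    ultimately show ?thesis by simp
  qed
qed

lemma fork_edges:
  assumes qs: "ipath qs" and rs: "ipath rs" and disj: "set qs \<inter> set rs = {}"
    and last_rs: "\<And>c d. c \<in> set rs \<Longrightarrow> d \<in> set qs \<Longrightarrow> (c, d) \<in> E \<Longrightarrow> c = last rs"
  shows "E \<inter> (set qs \<union> set rs) \<times> (set qs \<union> set rs)
    = symcl (pedges qs \<union> (pedges rs \<union> {last rs} \<times> {d \<in> set qs. (last rs, d) \<in> E}))"
proof (rule induced_Un)
  show "E \<inter> set qs \<times> set qs = symcl (pedges qs)" "E \<inter> set rs \<times> set rs = symcl (pedges rs)"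
    using qs rs by (simp_all add: ipath_def)
  have l: "last rs \<in> set rs" using rs by (simp add: ipath_def)
  then show "{last rs} \<times> {d \<in> set qs. (last rs, d) \<in> E} \<subseteq> set qs \<times> set rs \<union> set rs \<times> set qs"
    by auto
  show "(a, b) \<in> E \<longleftrightarrow> (a, b) \<in> symcl ({last rs} \<times> {d \<in> set qs. (last rs, d) \<in> E})"
    if "a \<in> set qs" "b \<in> set rs" for a b
    using that last_rs[of b a] E_sym l disj by (auto simp: in_symcl_iff)
qed

text \<open>Everything depends on the neighbours of \<open>last rs\<close> on \<open>qs\<close>.
  Minimality leaves either one of them or two consecutive ones. One at an end of \<open>qs\<close>
  makes \<open>B\<close> an induced path, one inside gives a claw and a wheel, and two give a
  triangle and a prism.\<close>

lemma fork_attachment: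
  assumes qs: "ipath qs" and rs: "ipath rs" and QR: "set qs \<inter> set rs = {}" "set qs \<union> set rs = B"
    and last_rs: "\<And>c d. c \<in> set rs \<Longrightarrow> d \<in> set qs \<Longrightarrow> (c, d) \<in> E \<Longrightarrow> c = last rs"
    and Z: "{p, q, r} \<subseteq> set zs" "p \<noteq> q" "q \<noteq> r" "p \<noteq> r"
    and ends: "(hd qs, p) \<in> E" "(last qs, q) \<in> E" "(hd rs, r) \<in> E"
    and c0: "c0 \<in> set qs" "(last rs, c0) \<in> E"
  shows "wheel_prism_K33 (ugraph (E \<inter> (set zs \<union> B) \<times> (set zs \<union> B)))"
proof -
  let ?N = "{d \<in> set qs. (last rs, d) \<in> E}"
  have ne: "qs \<noteq> []" "rs \<noteq> []" and dist: "distinct qs" "distinct rs"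
    using qs rs by (auto simp: ipath_def)
  have hl: "hd qs \<in> set qs" "last qs \<in> set qs" "hd rs \<in> set rs" "last rs \<in> set rs"
    using ne by auto
  have eb: "E \<inter> B \<times> B = symcl (pedges qs \<union> (pedges rs \<union> {last rs} \<times> ?N))"
    using fork_edges[OF qs rs QR(1) last_rs] by (simp add: QR(2))
  have crs: "conn (set rs)" using conn_walk ipath_edges rs ne by auto
  have Bzs: "set qs \<inter> set zs = {}" "set rs \<inter> set zs = {}" using disj QR by auto
  have consecutive: "ms = []"
    if s: "qs = as @ c # ms @ d # cs" and cd: "c \<in> ?N" "d \<in> ?N" for as c ms d cs
  proof (rule ccontr)
    assume "ms \<noteq> []"
    then obtain m where m: "m \<in> set ms" by (cases ms) auto
    have pe: "pedges qs \<subseteq> E" by (rule ipath_edges[OF qs])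
    have "conn (set (as @ [c]))"
      using pe s pedges_append[of "as @ [c]" "ms @ d # cs"] by (intro conn_walk) auto
    then have 1: "conn (set (as @ [c]) \<union> set rs)"
      using crs cd hl E_sym by (intro conn_Un) auto
    have "conn (set (d # cs))"
      using pe s pedges_append[of "as @ c # ms" "d # cs"] by (intro conn_walk) auto
    then have 2: "conn (set (as @ [c]) \<union> set rs \<union> set (d # cs))"
      by (rule conn_Un[OF 1]) (use cd hl in auto)
    have sub: "set (as @ [c]) \<union> set rs \<union> set (d # cs) \<subseteq> B" using s QR by auto
    have "hd qs \<in> set (as @ [c])" "last qs \<in> set (d # cs)" using s by (cases as; auto)+
    then have "{p, q, r} \<subseteq> att (set zs) (set (as @ [c]) \<union> set rs \<union> set (d # cs))"
      using ends hl Z unfolding att_def by blast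
    then have "set (as @ [c]) \<union> set rs \<union> set (d # cs) = B"
      by (rule eq_B[OF 2 sub _ Z(2-4)])
    moreover have "m \<in> set qs" using m s by simp
    then have "m \<in> B" "m \<notin> set rs" using QR by auto
    moreover have "m \<notin> set (as @ [c])" "m \<notin> set (d # cs)" using m dist(1) unfolding s by auto
    ultimately show False by blast
  qed
  let ?X = "{(p, hd qs), (q, last qs), (r, hd rs)}"
  have XB: "?X \<subseteq> set zs \<times> B \<union> B \<times> set zs" using hl QR Z by auto
  have induced: "ugraph (E \<inter> (set zs \<union> B) \<times> (set zs \<union> B))
      = ugraph (cedges zs \<union> (pedges qs \<union> (pedges rs \<union> {last rs} \<times> ?N) \<union> ?X))"
    if "c \<in> set (tl qs)" "(last rs, c) \<in> E" "d \<in> set (butlast qs)" "(last rs, d) \<in> E" for c d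
  proof (rule induced_ugraph[OF eb XB])
    fix z b assume zb: "z \<in> set zs" "b \<in> B"
    have "(b, z) \<notin> ?X" using zb Z disj by auto
    then show "(z, b) \<in> E \<longleftrightarrow> (z, b) \<in> symcl ?X"
      unfolding in_symcl_iff using fork_leaves[OF qs rs QR Z ends that zb] by (simp only: simp_thms)
  qed
  show ?thesis
  proof (cases "?N = {c0}")
    case True
    then have N: "(last rs, d) \<in> E \<longleftrightarrow> d = c0" if "d \<in> set qs" for d using that by blast
    obtain as cs where s: "qs = as @ c0 # cs" using c0 by (meson split_list)
    \<comment> \<open>At an end of \<open>qs\<close> the deletion used in \<open>fork_leaves\<close>
      would cut off \<open>rs\<close>, so the attachments are counted afresh by
      \<open>path_attachment\<close>.\<close>
    consider "as = []" | "cs = []" | "as \<noteq> []" "cs \<noteq> []" by blast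
    then show ?thesis
    proof cases
      case 1
      have "ipath (rs @ qs)"
        by (rule ipath_append[OF rs qs]) (use QR N last_rs s 1 in auto)
      moreover have "length (rs @ qs) \<ge> 2" using ne by (cases rs; cases qs) auto
      ultimately show ?thesis using path_attachment[of "rs @ qs"] QR by (simp add: Un_commute)
    next
      case 2
      have "ipath (qs @ rev rs)"
      proof (rule ipath_append[OF qs ipath_rev[OF rs]])
        fix x y assume "x \<in> set qs" "y \<in> set (rev rs)"
        then show "(x, y) \<in> E \<longleftrightarrow> x = last qs \<and> y = hd (rev rs)"
          using N[of x] last_rs[of y x] E_sym s 2 ne by (auto simp: hd_rev)
      qed (use QR in simp)
      moreover have "length (qs @ rev rs) \<ge> 2" using ne by (cases rs; cases qs) auto
      ultimately show ?thesis using path_attachment[of "qs @ rev rs"] QR by simp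
    next
      case 3
      have "c0 \<in> set (tl qs)" "c0 \<in> set (butlast qs)"
        using s 3 by (auto simp: butlast_append tl_append split: list.split)
      then have "ugraph (E \<inter> (set zs \<union> B) \<times> (set zs \<union> B))
          = ugraph (cedges zs \<union> (pedges qs \<union> (pedges rs \<union> {last rs} \<times> ?N) \<union> ?X))"
        using induced c0 by blast
      also have "\<dots> = ugraph (cedges zs \<union> pedges (p # qs @ [q]) \<union> pedges (r # rs @ [c0]))"
        unfolding True pedges_between[OF ne(1)] pedges_between[OF ne(2)]
        by (rule ugraph_cong) (simp add: symcl_def insert_commute Un_ac image_Un)
      finally show ?thesis
        using iso_to_subdivision_wheel_claw[OF distinct_zs Z dist(1) Bzs(1) c0(1) dist(2) Bzs(2)]
          QR(1) by (simp add: wheel_prism_K33_def Int_commute)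
    qed
  next
    case False
    then obtain d0 where d0: "d0 \<in> ?N" "d0 \<noteq> c0" using c0 by blast
    have "\<exists>as c d cs. qs = as @ c # d # cs \<and> c \<in> ?N \<and> d \<in> ?N"
    proof -
      have "c0 \<in> set qs" "d0 \<in> set qs" "c0 \<noteq> d0" using c0 d0 by auto
      then show ?thesis
      proof (cases rule: two_elements_split)
        case (1 as ms cs)
        then have "ms = []" using consecutive[OF 1] c0 d0 by simp
        then show ?thesis using 1 c0 d0 by auto
      next
        case (2 as ms cs)
        then have "ms = []" using consecutive[OF 2] c0 d0 by simp
        then show ?thesis using 2 c0 d0 by auto
      qed
    qed
    then obtain as c d cs where s: "qs = as @ c # d # cs" and cd: "c \<in> ?N" "d \<in> ?N" by blast
    \<comment> \<open>A third neighbour of \<open>last rs\<close> on \<open>qs\<close> would not be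
      consecutive with \<open>d\<close> or with \<open>c\<close>.\<close>
    have N: "?N = {c, d}"
    proof (intro equalityI subsetI)
      fix e assume e: "e \<in> ?N"
      then have "e \<in> set as \<or> e \<in> {c, d} \<or> e \<in> set cs" using s by auto
      moreover have False if "e \<in> set as"
      proof -
        obtain us vs where "as = us @ e # vs" using \<open>e \<in> set as\<close> by (meson split_list)
        then have "qs = us @ e # (vs @ [c]) @ d # cs" using s by simp
        from consecutive[OF this e cd(2)] show False by simp
      qed
      moreover have False if "e \<in> set cs"
      proof -
        obtain us vs where "cs = us @ e # vs" using \<open>e \<in> set cs\<close> by (meson split_list)
        then have "qs = as @ c # (d # us) @ e # vs" using s by simp
        from consecutive[OF this cd(1) e] show False by simp
      qed
      ultimately show "e \<in> {c, d}" by blast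
    qed (use cd in auto)
    define l where "l = last rs"
    define ts where "ts = butlast rs"
    have rs_eq: "rs = ts @ [l]" using ne by (simp add: l_def ts_def)
    have "d \<in> set (tl qs)" "c \<in> set (butlast qs)"
      using s by (auto simp: butlast_append tl_append split: list.split)
    then have "ugraph (E \<inter> (set zs \<union> B) \<times> (set zs \<union> B))
        = ugraph (cedges zs \<union> (pedges qs \<union> (pedges rs \<union> {last rs} \<times> ?N) \<union> ?X))"
      using induced cd by blast
    also have "\<dots> = ugraph (cedges zs \<union> (pedges (p # as @ [c]) \<union> pedges (q # rev cs @ [d]) \<union>
        pedges (r # ts @ [l]) \<union> {(c, d), (d, l), (l, c)}))"
    proof (rule ugraph_cong)
      \<comment> \<open>The part of \<open>qs\<close> behind \<open>d\<close> is reversed so that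
        every leg runs from the cycle towards the triangle.\<close>
      have 1: "symcl (pedges (q # rev cs @ [d])) = symcl (pedges (d # cs @ [q]))"
        using pedges_rev[of "d # cs @ [q]"] by simp
      have "pedges qs \<union> {(p, hd qs), (last qs, q)} = pedges (p # qs @ [q])"
        using pedges_between[OF ne(1)] by auto
      also have "\<dots> = pedges (p # as @ [c]) \<union> pedges (d # cs @ [q]) \<union> {(c, d)}"
        using pedges_append[of "p # as @ [c]" "d # cs @ [q]"] s by auto
      finally have 2: "symcl (pedges qs) \<union> symcl {(p, hd qs), (last qs, q)}
          = symcl (pedges (p # as @ [c])) \<union> symcl (pedges (d # cs @ [q])) \<union> symcl {(c, d)}"
        by (simp only: symcl_Un[symmetric])
      have 3: "pedges (r # ts @ [l]) = pedges rs \<union> {(r, hd rs)}"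
        using pedges_Cons[OF ne(2), of r] rs_eq by auto
      have 4: "symcl ?X = symcl {(p, hd qs), (last qs, q)} \<union> symcl {(r, hd rs)}"
        by (auto simp: in_symcl_iff)
      have 5: "symcl ({last rs} \<times> {c, d}) \<union> symcl {(c, d)} = symcl {(c, d), (d, l), (l, c)}"
        unfolding l_def by (simp add: symcl_def insert_commute)
      have "symcl (cedges zs \<union> (pedges qs \<union> (pedges rs \<union> {last rs} \<times> ?N) \<union> ?X))
        = symcl (cedges zs) \<union> (symcl (pedges qs) \<union> symcl {(p, hd qs), (last qs, q)}) \<union>
          (symcl (pedges rs) \<union> symcl {(r, hd rs)}) \<union> symcl ({last rs} \<times> {c, d})"
        unfolding N symcl_Un 4 by blast
      also have "\<dots> = symcl (cedges zs) \<union> symcl (pedges (p # as @ [c])) \<union>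
          symcl (pedges (d # cs @ [q])) \<union> symcl (pedges (r # ts @ [l])) \<union>
          symcl {(c, d), (d, l), (l, c)}"
        unfolding 2 3 symcl_Un 5[symmetric] by blast
      finally show "symcl (cedges zs \<union> (pedges qs \<union> (pedges rs \<union> {last rs} \<times> ?N) \<union> ?X))
        = symcl (cedges zs \<union> (pedges (p # as @ [c]) \<union> pedges (q # rev cs @ [d]) \<union>
          pedges (r # ts @ [l]) \<union> {(c, d), (d, l), (l, c)}))"
        unfolding symcl_Un 1 by blast
    qed
    finally have H: "ugraph (E \<inter> (set zs \<union> B) \<times> (set zs \<union> B)) =
        ugraph (cedges zs \<union> (pedges (p # as @ [c]) \<union> pedges (q # rev cs @ [d]) \<union>
        pedges (r # ts @ [l]) \<union> {(c, d), (d, l), (l, c)}))" .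
    have S: "set (as @ [c] @ rev cs @ [d] @ ts @ [l]) = set qs \<union> set rs"
      unfolding s rs_eq by auto
    have "distinct (as @ [c] @ rev cs @ [d] @ ts @ [l])"
      using dist QR(1) unfolding s rs_eq by auto
    moreover have "set (as @ [c] @ rev cs @ [d] @ ts @ [l]) \<inter> set zs = {}"
      unfolding S using Bzs by blast
    ultimately show ?thesis
      unfolding H wheel_prism_K33_def
      using iso_to_subdivision_prism_triangle[OF distinct_zs Z] by blast
  qed
qed

text \<open>A shortest path in \<open>B\<close> between neighbours of \<open>p\<close> and
  \<open>q\<close>, together with a shortest path from a neighbour of \<open>r\<close> to it if it
  does not see \<open>r\<close> itself, is connected with three attachments. Minimality makes it all
  of \<open>B\<close>.\<close>

lemma induced_subdivision:
  "wheel_prism_K33 (ugraph (E \<inter> (set zs \<union> B) \<times> (set zs \<union> B)))"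
proof -
  obtain T where T: "T \<subseteq> att (set zs) B" "card T = 3"
    using att_B obtain_subset_with_card_n by metis
  then obtain p q r where pqr: "T = {p, q, r}" "p \<noteq> q" "q \<noteq> r" "p \<noteq> r"
    by (auto simp: card_3_iff)
  then have Z: "{p, q, r} \<subseteq> set zs" and ex: "\<And>t. t \<in> {p, q, r} \<Longrightarrow> \<exists>b\<in>B. (b, t) \<in> E"
    using T by (auto simp: att_def)
  obtain b1 b2 where "b1 \<in> B" "(b1, p) \<in> E" "b2 \<in> B" "(b2, q) \<in> E" using ex by blast
  then obtain qs where qs: "ipath qs" "set qs \<subseteq> B"
    "set qs \<inter> {b. (b, p) \<in> E} = {hd qs}" "set qs \<inter> {b. (b, q) \<in> E} = {last qs}"
    using shortest_path_exists[OF conn_B, of b1 "{b. (b, p) \<in> E}" b2 "{b. (b, q) \<in> E}"] by blast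
  have qs_ne: "qs \<noteq> []" using qs(1) by (simp add: ipath_def)
  have cqs: "conn (set qs)" using conn_walk[OF qs_ne] ipath_edges[OF qs(1)] by blast
  have ends: "hd qs \<in> set qs" "(hd qs, p) \<in> E" "last qs \<in> set qs" "(last qs, q) \<in> E"
    using qs(3,4) by blast+
  show ?thesis
  proof (cases "r \<in> att (set zs) (set qs)")
    case True
    then have "{p, q, r} \<subseteq> att (set zs) (set qs)" using ends Z by (auto simp: att_def)
    then have B: "set qs = B" by (rule eq_B[OF cqs qs(2) _ pqr(2-4)])
    show ?thesis
    proof (cases "length qs \<ge> 2")
      case True
      then show ?thesis using path_attachment[OF qs(1) B] by simp
    next
      case False
      then obtain h where "qs = [h]" using qs_ne by (cases qs; cases "tl qs") auto
      then have "B = {h}" using B by simp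
      then show ?thesis by (rule single_vertex)
    qed
  next
    case False
    obtain y where y: "y \<in> B" "(y, r) \<in> E" using ex by blast
    with False Z have "y \<notin> set qs" by (auto simp: att_def)
    then have "{y} \<subseteq> B - set qs" using y by simp
    moreover have "finite (B - set qs)" using B_V finite_V finite_subset by auto
    ultimately obtain K where yK: "{y} \<subseteq> K" and comp: "component K (B - set qs)"
      by (rule component_exists[OF conn_singleton])
    note K = yK componentD[OF comp]
    have "K \<subseteq> B" "hd qs \<in> B" "hd qs \<notin> K" "y \<in> K" using K ends qs(2) by auto
    then obtain a b where ab: "a \<in> K" "b \<in> B" "b \<notin> K" "(a, b) \<in> E"
      using connD[OF conn_B, of K y "hd qs"] by metis
    then have "b \<in> set qs" using K(4) by blast
    let ?R = "{c. (c, r) \<in> E}" and ?A = "{c. \<exists>d\<in>set qs. (c, d) \<in> E}"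
    have "y \<in> K" "y \<in> ?R" "a \<in> K" "a \<in> ?A" using K y ab \<open>b \<in> set qs\<close> by auto
    then obtain rs where rs: "ipath rs" "set rs \<subseteq> K"
      "set rs \<inter> ?R = {hd rs}" "set rs \<inter> ?A = {last rs}"
      by (rule shortest_path_exists[OF K(3)])
    have rs_ne: "rs \<noteq> []" using rs(1) by (simp add: ipath_def)
    have crs: "conn (set rs)" using conn_walk[OF rs_ne] ipath_edges[OF rs(1)] by blast
    have hr: "(hd rs, r) \<in> E" "hd rs \<in> set rs" using rs(3) by blast+
    obtain c0 where c0: "c0 \<in> set qs" "(last rs, c0) \<in> E" "last rs \<in> set rs" using rs(4) by blast
    have QR: "set qs \<inter> set rs = {}" using rs(2) K(2) by blast
    have "conn (set qs \<union> set rs)" using cqs crs c0 E_sym by (intro conn_Un) blast+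
    moreover have "set qs \<union> set rs \<subseteq> B" using qs(2) rs(2) K(2) by blast
    moreover have "{p, q, r} \<subseteq> att (set zs) (set qs \<union> set rs)"
      using ends hr Z unfolding att_def by blast
    ultimately have B: "set qs \<union> set rs = B" by (rule eq_B[OF _ _ _ pqr(2-4)])
    \<comment> \<open>\<open>rs\<close> was chosen as short as possible towards \<open>qs\<close>,
      so only its last vertex touches \<open>qs\<close>.\<close>
    have "c = last rs" if "c \<in> set rs" "d \<in> set qs" "(c, d) \<in> E" for c d
      using that rs(4) by blast
    then show ?thesis
      by (rule fork_attachment[OF qs(1) rs(1) QR B _ Z pqr(2-4) ends(2,4) hr(1) c0(1,2)])
  qed
qed

end

section \<open>4-connected graphs\<close>

locale four_connected = simple_graph V E for V :: "'a set" and E +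
  assumes card_V: "card V > 4" and conn_Diff: "\<And>S. S \<subseteq> V \<Longrightarrow> card S < 4 \<Longrightarrow> conn (V - S)"
begin

definition is_cycle :: "'a list \<Rightarrow> bool" where
  "is_cycle zs \<longleftrightarrow> distinct zs \<and> length zs \<ge> 3 \<and> cedges zs \<subseteq> E"

lemma nbrs_V: "nbrs K \<subseteq> V"
  using E_V by (auto simp: nbrs_def)

lemma finite_nbrs [simp]: "finite (nbrs K)"
  using nbrs_V finite_V finite_subset by blast

text \<open>Otherwise \<open>nbrs K\<close> would be a set of fewer than four vertices separating
  \<open>K\<close> from \<open>y\<close>.\<close>

lemma card_nbrs_ge_4:
  assumes "K \<subseteq> V" "k \<in> K" "y \<in> V" "y \<notin> K" "y \<notin> nbrs K"
  shows "card (nbrs K) \<ge> 4"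
proof (rule ccontr)
  assume "\<not> ?thesis"
  then have "conn (V - nbrs K)" using conn_Diff nbrs_V by simp
  moreover have "K \<subseteq> V - nbrs K" using assms by (auto simp: nbrs_def)
  ultimately obtain a b where "a \<in> K" "b \<in> V - nbrs K" "b \<notin> K" "(a, b) \<in> E"
    using connD[of "V - nbrs K" K k y] assms by blast
  then show False by (auto simp: nbrs_def)
qed

text \<open>If \<open>v\<close> is adjacent to all other vertices, there is nothing to separate from
  it, and \<open>card V > 4\<close> provides the bound.\<close>

lemma min_degree:
  assumes "v \<in> V"
  shows "card (nbrs {v}) \<ge> 4"
proof (cases "V \<subseteq> insert v (nbrs {v})")
  case True
  then have "card V \<le> card (insert v (nbrs {v}))" by (intro card_mono) simp_all
  also have "\<dots> \<le> Suc (card (nbrs {v}))" by (simp add: card_insert_if)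
  finally show ?thesis using card_V by linarith
next
  case False
  then show ?thesis using card_nbrs_ge_4[of "{v}" v] assms by blast
qed

section \<open>Cycles and the choice of a non-separating induced one\<close>

lemma is_cycle_V: "is_cycle zs \<Longrightarrow> set zs \<subseteq> V"
  using Field_cedges[of zs] E_V by (auto simp: is_cycle_def Field_def)

lemma cycle_close:
  assumes "pedges (u # as @ [v]) \<subseteq> E" "pedges xs \<subseteq> E" "xs \<noteq> []" "(v, hd xs) \<in> E" "(last xs, u) \<in> E"
    and "distinct (u # as @ v # xs)"
  shows "is_cycle (u # as @ v # xs)"
proof -
  have "pedges (u # as @ v # xs) \<subseteq> E"
    using pedges_append[of "u # as @ [v]" xs] assms by auto
  moreover have "length xs \<ge> 1" using assms(3) by (cases xs) auto
  ultimately show ?thesis using assms by (simp add: is_cycle_def cedges_def)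
qed

text \<open>Two neighbours of some \<open>a \<noteq> x\<close> are joined by a path in
  \<open>V - {a, x}\<close>, which is still connected; \<open>a\<close> closes this path to a
  cycle.\<close>

lemma cycle_avoiding_vertex:
  assumes x: "x \<in> V"
  obtains zs where "is_cycle zs" "x \<notin> set zs"
proof -
  have "card {x} < card V" using card_V by simp
  then obtain a where a: "a \<in> V" "a \<noteq> x"
    by (metis card_mono finite.emptyI finite.insertI insertI1 not_le singletonD subsetI)
  have "2 \<le> card (nbrs {a} - {x})"
    using min_degree[OF a(1)] diff_card_le_card_Diff[of "{x}" "nbrs {a}"] by simp
  then obtain U where U: "U \<subseteq> nbrs {a} - {x}" "card U = 2" "finite U"
    by (rule obtain_subset_with_card_n)
  then obtain u w where uw: "U = {u, w}" "u \<noteq> w" by (auto simp: card_2_iff)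
  have S: "conn (V - {a, x})" using conn_Diff[of "{a, x}"] a x by simp
  have u: "u \<in> V - {a, x}" "w \<in> V - {a, x}" "(a, u) \<in> E" "(a, w) \<in> E"
    using U uw nbrs_V[of "{a}"] by (auto simp: nbrs_def)
  obtain xs where xs: "ipath xs" "set xs \<subseteq> V - {a, x}"
    "set xs \<inter> {u} = {hd xs}" "set xs \<inter> {w} = {last xs}"
    using shortest_path_exists[OF S u(1) _ u(2), of "{u}" "{w}"] by blast
  have hl: "hd xs = u" "last xs = w" using xs(3,4) by auto
  obtain ys where ys: "xs = u # ys" "ys \<noteq> []"
    using xs(1) hl uw by (cases xs) (auto simp: ipath_def split: if_splits)
  have "is_cycle (a # [] @ u # ys)"
  proof (rule cycle_close)
    have "pedges xs \<subseteq> E" by (rule ipath_edges[OF xs(1)])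
    then show "pedges ys \<subseteq> E" "(u, hd ys) \<in> E" using ys by (auto simp: pedges_Cons)
    show "(last ys, a) \<in> E" using hl u E_sym ys by auto
    show "distinct (a # [] @ u # ys)" using xs(1,2) ys by (auto simp: ipath_def)
  qed (use u ys in auto)
  moreover have "x \<notin> set (a # [] @ u # ys)" using xs(2) ys a by auto
  ultimately show thesis by (rule that)
qed

text \<open>\<open>d1\<close> and \<open>d2\<close> cut the cycle into the arcs \<open>as\<close>
  and \<open>bs\<close>; the arc that contains \<open>a\<close> is exchanged for
  \<open>xs\<close>.\<close>

lemma reroute_cycle:
  assumes zs: "is_cycle zs" and d: "d1 \<in> set zs" "d2 \<in> set zs" "d1 \<noteq> d2"
    and a: "a \<in> set zs" "a \<noteq> d1" "a \<noteq> d2"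
    and xs: "pedges xs \<subseteq> E" "xs \<noteq> []" "distinct xs" "set xs \<inter> set zs = {}"
      "(d1, hd xs) \<in> E" "(last xs, d2) \<in> E"
  obtains zs' where "is_cycle zs'" "set zs' \<subseteq> set zs \<union> set xs - {a}"
proof -
  obtain us vs where z: "zs = us @ d1 # vs" using d by (meson split_list)
  have "d2 \<in> set (vs @ us)" using d z by auto
  then obtain as bs where ab: "vs @ us = as @ d2 # bs" by (meson split_list)
  have st: "set zs = set (d1 # as @ d2 # bs)" "distinct (d1 # as @ d2 # bs)"
  proof -
    have "set zs = insert d1 (set (vs @ us))" using z by auto
    then show "set zs = set (d1 # as @ d2 # bs)" unfolding ab by simp
    have "distinct (d1 # vs @ us)" using zs z by (auto simp: is_cycle_def)
    then show "distinct (d1 # as @ d2 # bs)" using ab by simp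
  qed
  have "cedges (d1 # as @ d2 # bs) \<subseteq> E"
    using zs cedges_rotate[of us "d1 # vs"] ab by (simp add: z is_cycle_def)
  then have e: "pedges (d1 # as @ d2 # bs) \<subseteq> E" "(last (d2 # bs), d1) \<in> E"
    by (auto simp: cedges_def)
  have e1: "pedges (d1 # as @ [d2]) \<subseteq> E"
    using e(1) pedges_append[of "d1 # as @ [d2]" bs] by (cases "bs = []") auto
  have "pedges (d2 # bs) \<subseteq> E" using e(1) pedges_append[of "d1 # as" "d2 # bs"] by auto
  then have e2: "pedges (d2 # bs @ [d1]) \<subseteq> E"
    using e(2) pedges_append[of "d2 # bs" "[d1]"] by auto
  show thesis
  proof (cases "a \<in> set bs")
    case True
    have "is_cycle (d1 # as @ d2 # rev xs)"
    proof (rule cycle_close[OF e1])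
      show "pedges (rev xs) \<subseteq> E"
      proof -
        have "pedges (rev xs) \<subseteq> symcl (pedges xs)"
          unfolding pedges_rev[of xs, symmetric] by (auto simp: symcl_def)
        also have "\<dots> \<subseteq> E" using xs(1) E_sym by (auto simp: symcl_def)
        finally show ?thesis .
      qed
      show "(d2, hd (rev xs)) \<in> E" "(last (rev xs), d1) \<in> E"
        using xs E_sym by (auto simp: hd_rev last_rev)
      show "distinct (d1 # as @ d2 # rev xs)" using st xs by auto
    qed (use xs in auto)
    moreover have "a \<notin> set (d1 # as @ d2 # rev xs)" using True st(2) a xs(4) by auto
    ultimately show thesis using that[of "d1 # as @ d2 # rev xs"] st(1) by auto
  next
    case False
    have "is_cycle (d2 # bs @ d1 # xs)"
      by (rule cycle_close[OF e2 xs(1,2,5,6)]) (use st xs in auto)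
    moreover have "a \<notin> set (d2 # bs @ d1 # xs)" using False a xs(4) by auto
    ultimately show thesis using that[of "d2 # bs @ d1 # xs"] st(1) by auto
  qed
qed

text \<open>The key property is \<open>full\<close>: every cycle avoiding the maximal
  \<open>C\<close> covers \<open>V - C\<close>. It excludes chords, since a chord would close a
  shorter cycle that also avoids \<open>C\<close>, and it identifies \<open>V - set zs\<close> with
  the connected set \<open>C\<close>.\<close>

lemma nonseparating_induced_cycle:
  assumes x: "x \<in> V"
  obtains zs where "icycle zs" "set zs \<subseteq> V" "x \<notin> set zs" "conn (V - set zs)"
proof -
  let ?P = "\<lambda>C. C \<subseteq> V \<and> x \<in> C \<and> conn C \<and> (\<exists>zs. is_cycle zs \<and> set zs \<inter> C = {})"
  obtain zs0 where "is_cycle zs0" "x \<notin> set zs0" using cycle_avoiding_vertex[OF x] by blast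
  then have "?P {x}" using x by auto
  moreover have "\<forall>C. ?P C \<longrightarrow> card C < Suc (card V)"
    using finite_V by (simp add: card_mono less_Suc_eq_le)
  ultimately have "\<exists>C. ?P C \<and> (\<forall>D. ?P D \<longrightarrow> card D \<le> card C)"
    by (rule ex_has_greatest_nat)
  then obtain C where "?P C \<and> (\<forall>D. ?P D \<longrightarrow> card D \<le> card C)" by (rule exE)
  note C = conjunct1[OF this] and max = mp[OF spec[OF conjunct2[OF this]]]
  have fin: "finite C" using C finite_V finite_subset by blast
  have no_ext: False if "is_cycle zs" "set zs \<inter> C = {}" "c \<in> C" "(c, v) \<in> E" "v \<notin> C" "v \<notin> set zs"
    for zs c v
  proof -
    have "?P (insert v C)" using C that conn_insert E_V by blast
    from max[OF this] show False using fin that by simp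
  qed
  have full: "set zs = V - C" if zs: "is_cycle zs" "set zs \<inter> C = {}" for zs
  proof (rule ccontr)
    assume "set zs \<noteq> V - C"
    then obtain v where v: "v \<in> V" "v \<notin> C" "v \<notin> set zs" using is_cycle_V[OF zs(1)] zs(2) by blast
    have nC: "nbrs C \<subseteq> set zs" using no_ext[OF zs] by (auto simp: nbrs_def)
    \<comment> \<open>\<open>v\<close> here, and \<open>x\<close> for \<open>D\<close> below, are
      the vertices that the neighbourhood would separate off. Four neighbours of \<open>C\<close>
      leave one besides \<open>d1\<close> and \<open>d2\<close>.\<close>
    have "card (nbrs C) \<ge> 4" by (rule card_nbrs_ge_4[of C x v]) (use C v nC in auto)
    have "{v} \<subseteq> V - C - set zs" "finite (V - C - set zs)" using v finite_V by auto
    then obtain D where vD: "{v} \<subseteq> D" and comp: "component D (V - C - set zs)"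
      by (rule component_exists[OF conn_singleton])
    note D = vD componentD[OF comp]
    have nD: "nbrs D \<subseteq> set zs"
    proof
      fix b assume "b \<in> nbrs D"
      then obtain a where a: "a \<in> D" "(a, b) \<in> E" "b \<notin> D" by (auto simp: nbrs_def)
      have "b \<in> V" using a E_V by auto
      moreover have "b \<notin> C" using no_ext[OF zs, of b a] a D(2) E_sym by blast
      ultimately show "b \<in> set zs" using D(4) a by blast
    qed
    have xD: "x \<notin> D" "x \<notin> nbrs D" using C D(2) nD zs(2) by auto
    have "card (nbrs D) \<ge> 4" by (rule card_nbrs_ge_4[of D v x]) (use D v x xD in auto)
    then have "2 \<le> card (nbrs D)" by linarith
    then obtain U where U: "U \<subseteq> nbrs D" "card U = 2" "finite U"
      by (rule obtain_subset_with_card_n)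
    then obtain d1 d2 where d: "U = {d1, d2}" "d1 \<noteq> d2" by (auto simp: card_2_iff)
    have "\<not> nbrs C \<subseteq> {d1, d2}"
      using card_mono[of "{d1, d2}" "nbrs C"] \<open>card (nbrs C) \<ge> 4\<close> d by auto
    then obtain a where a: "a \<in> nbrs C" "a \<noteq> d1" "a \<noteq> d2" by blast
    then obtain c where c: "c \<in> C" "(c, a) \<in> E" "a \<notin> C" by (auto simp: nbrs_def)
    obtain e1 e2 where e: "e1 \<in> D" "(e1, d1) \<in> E" "e2 \<in> D" "(e2, d2) \<in> E"
      using U d by (auto simp: nbrs_def)
    \<comment> \<open>\<open>d1\<close>, \<open>d2\<close> split the cycle into two arcs; a path through \<open>D\<close> replaces the one that contains
      \<open>a\<close>, which then can be moved to \<open>C\<close>.\<close>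
    obtain xs where xs: "ipath xs" "set xs \<subseteq> D"
      "set xs \<inter> {e. (e, d1) \<in> E} = {hd xs}" "set xs \<inter> {e. (e, d2) \<in> E} = {last xs}"
      using shortest_path_exists[OF D(3) e(1) _ e(3), of "{e. (e, d1) \<in> E}" "{e. (e, d2) \<in> E}"] e
      by blast
    have "(hd xs, d1) \<in> E" "(last xs, d2) \<in> E" using xs(3,4) by blast+
    moreover have "xs \<noteq> []" "distinct xs" using xs(1) by (auto simp: ipath_def)
    moreover have "set xs \<inter> set zs = {}" using xs(2) D(2) by blast
    moreover have "d1 \<in> set zs" "d2 \<in> set zs" "a \<in> set zs" using U d nD a nC by auto
    ultimately obtain zs' where zs': "is_cycle zs'" "set zs' \<subseteq> set zs \<union> set xs - {a}"
      using reroute_cycle[OF zs(1) _ _ d(2) _ a(2,3) ipath_edges[OF xs(1)]] E_sym by metis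
    have "set zs' \<inter> C = {}" "a \<notin> set zs'" using zs' zs(2) xs(2) D(2) by auto
    then show False using no_ext[OF zs'(1) _ c(1,2,3)] by blast
  qed
  obtain zs where zs: "is_cycle zs" "set zs \<inter> C = {}" using C by blast
  have set_zs: "set zs = V - C" by (rule full[OF zs])
  have dist: "distinct zs" and len: "length zs \<ge> 3" and ce: "cedges zs \<subseteq> E"
    using zs by (simp_all add: is_cycle_def)
  \<comment> \<open>By \<open>full\<close> the cycle closed by the chord has all vertices of
    \<open>zs\<close>, so the chord joins the two ends of the list and is the closing edge.\<close>
  have chord: "(a, b) \<in> symcl (cedges zs)"
    if ab: "(a, b) \<in> E" and s: "zs = as @ a # ms @ b # cs" for a b as ms cs
  proof (cases "ms = []")
    case True
    then have "(a, b) \<in> pedges zs" using s by (cases "as = []") (auto simp: pedges_append)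
    then show ?thesis by (simp add: cedges_def in_symcl_iff)
  next
    case False
    have "pedges zs \<subseteq> E" using ce by (simp add: cedges_def)
    moreover have "pedges (a # ms @ [b]) \<subseteq> pedges zs"
    proof -
      have "pedges (a # ms @ [b]) \<subseteq> pedges (a # ms @ b # cs)"
        using pedges_append[of "a # ms @ [b]" cs] by (cases "cs = []") auto
      also have "\<dots> \<subseteq> pedges zs" unfolding s by (cases "as = []") (auto simp: pedges_append)
      finally show ?thesis .
    qed
    moreover have "length ms \<ge> 1" using False by (cases ms) auto
    ultimately have "is_cycle (a # ms @ [b])"
      using ab E_sym dist unfolding s by (auto simp: is_cycle_def cedges_def)
    moreover have "set (a # ms @ [b]) \<inter> C = {}" using zs(2) s by auto
    ultimately have "set (a # ms @ [b]) = set zs" using full set_zs by blast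
    moreover have "distinct (a # ms @ [b])" using dist unfolding s by auto
    ultimately have "length (a # ms @ [b]) = length zs" using dist distinct_card by metis
    then have "as = []" "cs = []" unfolding s by auto
    then have "(b, a) = (last zs, hd zs)" using s by simp
    then show ?thesis by (simp add: cedges_def in_symcl_iff)
  qed
  have "E \<inter> set zs \<times> set zs = symcl (cedges zs)"
  proof (intro equalityI subrelI)
    fix a b assume "(a, b) \<in> E \<inter> set zs \<times> set zs"
    then have ab: "(a, b) \<in> E" "a \<in> set zs" "b \<in> set zs" by auto
    then have "a \<noteq> b" using E_irrefl by auto
    with ab(2,3) show "(a, b) \<in> symcl (cedges zs)"
    proof (cases rule: two_elements_split)
      case (1 as ms cs)
      then show ?thesis using chord ab(1) by blast
    next
      case (2 as ms cs)
      then have "(b, a) \<in> symcl (cedges zs)" using chord ab(1) E_sym by blast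
      then show ?thesis by (auto simp: in_symcl_iff)
    qed
  next
    fix a b assume "(a, b) \<in> symcl (cedges zs)"
    then have "(a, b) \<in> E" "a \<in> Field (cedges zs)" "b \<in> Field (cedges zs)"
      using ce E_sym by (auto simp: in_symcl_iff Field_def)
    then show "(a, b) \<in> E \<inter> set zs \<times> set zs" using Field_cedges[of zs] len by auto
  qed
  then have "icycle zs" using dist len by (simp add: icycle_def)
  moreover have "V - set zs = C" using set_zs C by blast
  moreover have "set zs \<subseteq> V" "x \<notin> set zs" using set_zs C by auto
  ultimately show thesis using C by (intro that[of zs]) simp_all
qed

text \<open>A vertex of an induced cycle has two neighbours on it; with \<open>x\<close> these are
  at most three, against minimum degree four.\<close>

lemma icycle_not_almost_spanning:
  assumes zs: "icycle zs" "set zs \<subseteq> V"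
  shows "\<not> V \<subseteq> insert x (set zs)"
proof
  assume V: "V \<subseteq> insert x (set zs)"
  obtain a t where t: "zs = a # t" "t \<noteq> []" using zs(1) by (cases zs; cases "tl zs") (auto simp: icycle_def)
  have at: "a \<notin> set t" using zs(1) t by (auto simp: icycle_def)
  have "nbrs {a} \<subseteq> {x, hd t, last t}"
  proof
    fix b assume "b \<in> nbrs {a}"
    then have b: "(a, b) \<in> E" by (auto simp: nbrs_def)
    then consider "b = x" | "b \<in> set zs" using V E_V by auto
    then show "b \<in> {x, hd t, last t}"
    proof cases
      case 2
      have "a \<in> set zs" using t by simp
      then have "(a, b) \<in> E \<inter> set zs \<times> set zs" using 2 b by blast
      then have "(a, b) \<in> symcl (cedges zs)" using zs(1) unfolding icycle_def by blast
      then show ?thesis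
        using at t pedgesD[of a b t] pedgesD2[of b a t]
        by (auto simp: in_symcl_iff cedges_def pedges_Cons)
    qed simp
  qed
  then have "card (nbrs {a}) \<le> card {x, hd t, last t}" by (intro card_mono) auto
  also have "\<dots> \<le> 3" by (simp add: card_insert_if)
  finally show False using min_degree[of a] zs(2) t by auto
qed

text \<open>\<open>?P\<close> keeps the rest connected and is minimised by cardinality. The
  inclusion \<open>BA\<close> then upgrades the choice: every proper connected subset misses some
  vertex of \<open>?A\<close>, and \<open>few\<close> bounds its attachments.\<close>

lemma minimal_attachment_exists:
  assumes zs: "icycle zs" "set zs \<subseteq> V" and x: "x \<in> V" "x \<notin> set zs" and conn: "conn (V - set zs)"
  obtains B where "minimal_attachment V E zs B" "x \<notin> B" "conn (V - set zs - B)"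
proof -
  let ?Z = "set zs"
  let ?P = "\<lambda>B. B \<subseteq> V - ?Z - {x} \<and> conn B \<and> conn (V - ?Z - B) \<and> card (att ?Z B) \<ge> 3"
  have fin_att: "finite (att ?Z K)" for K by (simp add: att_def)
  obtain y where "y \<in> V - ?Z - {x}" using icycle_not_almost_spanning[OF zs] by blast
  then have "{y} \<subseteq> V - ?Z - {x}" "finite (V - ?Z - {x})" using finite_V by auto
  then obtain K where yK: "{y} \<subseteq> K" and compK: "component K (V - ?Z - {x})"
    by (rule component_exists[OF conn_singleton])
  note K = yK componentD[OF compK]
  have "?P K"
  proof (intro conjI)
    show "conn (V - ?Z - K)" by (rule conn_remove_component[OF conn _ compK]) (use x in auto)
    have sub: "nbrs K - {x} \<subseteq> att ?Z K"
    proof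
      fix b assume b: "b \<in> nbrs K - {x}"
      then obtain a where "a \<in> K" "(a, b) \<in> E" "b \<notin> K" by (auto simp: nbrs_def)
      moreover then have "b \<in> ?Z" using K(4)[of a b] b nbrs_V by blast
      ultimately show "b \<in> att ?Z K" by (auto simp: att_def)
    qed
    show "card (att ?Z K) \<ge> 3"
    \<comment> \<open>Fewer than four neighbours are possible only if \<open>K\<close> and its
      neighbours exhaust \<open>V\<close>; then all of the cycle is attached to
      \<open>K\<close>.\<close>
    proof (cases "card (nbrs K) \<ge> 4")
      case True
      have "card (nbrs K) - 1 \<le> card (nbrs K - {x})"
        using diff_card_le_card_Diff[of "{x}" "nbrs K"] by simp
      also have "\<dots> \<le> card (att ?Z K)" by (rule card_mono[OF fin_att sub])
      finally show ?thesis using True by linarith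
    next
      case False
      then have "V \<subseteq> K \<union> nbrs K" using card_nbrs_ge_4[of K y] K by blast
      then have "?Z \<subseteq> att ?Z K" using sub zs(2) K(2) x by blast
      then have "card ?Z \<le> card (att ?Z K)" by (rule card_mono[OF fin_att])
      moreover have "card ?Z \<ge> 3" using zs(1) by (simp add: icycle_def distinct_card)
      ultimately show ?thesis by linarith
    qed
  qed (use K in auto)
  then have "\<exists>B. ?P B \<and> (\<forall>L. ?P L \<longrightarrow> card B \<le> card L)"
    by (rule ex_has_least_nat)
  then obtain B where "?P B \<and> (\<forall>L. ?P L \<longrightarrow> card B \<le> card L)" by (rule exE)
  note B = conjunct1[OF this] and min = mp[OF spec[OF conjunct2[OF this]]]
  let ?C = "V - ?Z - B"
  let ?A = "{b. \<exists>c\<in>?C. (c, b) \<in> E}"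
  have xC: "x \<in> ?C" using B x by blast
  have finB: "finite B" using B finite_V finite_subset by blast
  \<comment> \<open>The component \<open>M\<close> of \<open>B - {v}\<close> around \<open>L\<close>
    is smaller than \<open>B\<close>, and \<open>v\<close> connects \<open>B - M\<close> to
    \<open>?C\<close>. Of the conditions in \<open>?P\<close>, only the one on attachments can fail
    for \<open>M\<close>.\<close>
  have few: "card (att ?Z L) \<le> 2" if v: "v \<in> B" "v \<in> ?A" and L: "conn L" "L \<subseteq> B - {v}" for v L
  proof -
    have "finite (B - {v})" using finB by simp
    then obtain M where LM: "L \<subseteq> M" and compM: "component M (B - {v})"
      by (rule component_exists[OF L])
    note M = LM componentD[OF compM]
    have "conn (B - M)" by (rule conn_remove_component[OF _ v(1) compM]) (use B in auto)
    moreover obtain c where "c \<in> ?C" "(c, v) \<in> E" using v by blast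
    moreover have "v \<in> B - M" using v M(2) by blast
    ultimately have "conn (?C \<union> (B - M))" using B by (intro conn_Un) blast+
    moreover have "?C \<union> (B - M) = V - ?Z - M" using M(2) B by blast
    ultimately have rest: "conn (V - ?Z - M)" by simp
    have "card M < card B" by (rule psubset_card_mono[OF finB]) (use M(2) v in blast)
    then have "\<not> ?P M" using min[of M] by linarith
    then have "card (att ?Z M) < 3" using M(2,3) rest B by auto
    moreover have "card (att ?Z L) \<le> card (att ?Z M)"
      by (rule card_mono[OF fin_att att_mono[OF M(1)]])
    ultimately show ?thesis by linarith
  qed
  have "\<exists>b\<in>B. b \<in> ?A"
  proof -
    obtain b0 where "b0 \<in> B" using B conn_nonempty by blast
    then obtain c b where "c \<in> ?C" "b \<in> V - ?Z" "b \<notin> ?C" "(c, b) \<in> E"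
      using connD[OF conn, of ?C x b0] xC B by blast
    then show ?thesis by blast
  qed
  then obtain bA where bA: "bA \<in> B" "bA \<in> ?A" by blast
  have BA: "B \<subseteq> ?A"
  proof (rule ccontr)
    assume "\<not> B \<subseteq> ?A"
    then obtain b where "b \<in> B - ?A" by blast
    then have "{b} \<subseteq> B - ?A" "finite (B - ?A)" using finB by auto
    then obtain X where bX: "{b} \<subseteq> X" and compX: "component X (B - ?A)"
      by (rule component_exists[OF conn_singleton])
    note X = bX componentD[OF compX]
    let ?W = "nbrs X \<inter> B"
    have WA: "?W \<subseteq> ?A" using X(4) by (auto simp: nbrs_def)
    have X_C: "(a, c) \<notin> E" if "a \<in> X" "c \<in> ?C" for a c using X(2) that E_sym by blast
    \<comment> \<open>Lying outside \<open>?A\<close>, the set \<open>X\<close> has no edge to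
      \<open>?C\<close>, so its neighbours are in \<open>B\<close> or on the cycle.\<close>
    have sub: "nbrs X \<subseteq> ?W \<union> att ?Z X"
      using X_C nbrs_V[of X] by (auto simp: nbrs_def att_def)
    have "card (nbrs X) \<ge> 4"
    proof (rule card_nbrs_ge_4[of X b x])
      show "x \<notin> nbrs X" using X_C[OF _ xC] by (auto simp: nbrs_def)
    qed (use X B x in auto)
    also have "card (nbrs X) \<le> card (?W \<union> att ?Z X)"
      by (rule card_mono[OF _ sub]) (use finB fin_att in auto)
    also have "\<dots> \<le> card ?W + card (att ?Z X)" by (rule card_Un_le)
    finally have four: "card ?W + card (att ?Z X) \<ge> 4" .
    have "\<exists>K. X \<subseteq> K \<and> component K (B - {w})" if "w \<in> ?W" for w
    proof -
      have "X \<subseteq> B - {w}" using X(2) that by (auto simp: nbrs_def)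
      moreover have "finite (B - {w})" using finB by simp
      ultimately show ?thesis by (rule component_exists[OF X(3)]) blast
    qed
    then obtain Kf where X_Kf: "\<And>w. w \<in> ?W \<Longrightarrow> X \<subseteq> Kf w"
      and compKf: "\<And>w. w \<in> ?W \<Longrightarrow> component (Kf w) (B - {w})" by metis
    note Kf = X_Kf componentD[OF compKf]
    have att2: "card (att ?Z (Kf w)) \<le> 2" if "w \<in> ?W" for w
      using few[OF _ _ Kf(3)[OF that] Kf(2)[OF that]] that WA by blast
    \<comment> \<open>\<open>few\<close> allows the component around \<open>X\<close> at most two
      attachments, so at least one attachment of \<open>B\<close> is lost by deleting
      \<open>w\<close>.\<close>
    have "\<exists>t. t \<in> att ?Z B \<and> t \<notin> att ?Z (Kf w)" if "w \<in> ?W" for w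
    proof (rule ccontr)
      assume "\<not> ?thesis"
      then have "card (att ?Z B) \<le> card (att ?Z (Kf w))" by (intro card_mono fin_att) blast
      then show False using att2[OF that] B by linarith
    qed
    then obtain t where t: "\<And>w. w \<in> ?W \<Longrightarrow> t w \<in> att ?Z B" "\<And>w. w \<in> ?W \<Longrightarrow> t w \<notin> att ?Z (Kf w)"
      by metis
    \<comment> \<open>\<open>B - Kf w'\<close> is connected, contains \<open>w'\<close>, and avoids
      \<open>w\<close> because \<open>w\<close> is adjacent to \<open>X\<close> and so lies in
      \<open>Kf w'\<close>. Hence it is swallowed by \<open>Kf w\<close>, and it carries all
      neighbours of \<open>t w'\<close> in \<open>B\<close>.\<close>
    have cross: "t w' \<in> att ?Z (Kf w)" if w: "w \<in> ?W" "w' \<in> ?W" "w \<noteq> w'" for w w'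
    proof -
      have nb: "v \<in> Kf u" if uv: "u \<in> ?W" "v \<in> ?W" "u \<noteq> v" for u v
      proof -
        obtain a where "a \<in> X" "(a, v) \<in> E" using uv(2) by (auto simp: nbrs_def)
        then show ?thesis using Kf(1)[OF uv(1)] Kf(4)[OF uv(1), of a v] uv by blast
      qed
      have "conn (B - Kf w')"
        by (rule conn_remove_component[OF _ _ compKf[OF w(2)]]) (use B w in auto)
      moreover have "B - Kf w' \<subseteq> B - {w}" using nb[OF w(2,1)] w(3) by blast
      moreover have "w' \<in> (B - Kf w') \<inter> Kf w" using nb[OF w] Kf(2)[OF w(2)] w(2) by blast
      ultimately have "B - Kf w' \<subseteq> Kf w"
        using component_absorb[OF compKf[OF w(1)]] by blast
      moreover obtain b where "b \<in> B" "(b, t w') \<in> E" "t w' \<in> ?Z" using t(1)[OF w(2)] by (auto simp: att_def)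
      moreover then have "b \<notin> Kf w'" using t(2)[OF w(2)] by (auto simp: att_def)
      ultimately show ?thesis by (auto simp: att_def)
    qed
    \<comment> \<open>\<open>bA\<close> is a vertex of \<open>B\<close> outside \<open>X\<close>;
      connectedness of \<open>B\<close> then makes \<open>?W\<close> non-empty, which supplies
      \<open>w0\<close>.\<close>
    have "bA \<notin> X" "b \<in> X" using bA X(1,2) by auto
    moreover have "conn B" "X \<subseteq> B" using B X(2) by auto
    ultimately obtain a w0 where "a \<in> X" "w0 \<in> B" "w0 \<notin> X" "(a, w0) \<in> E"
      using connD[of B X b bA] bA(1) by metis
    then have w0: "w0 \<in> ?W" by (auto simp: nbrs_def)
    \<comment> \<open>Each \<open>w\<close> hides from \<open>X\<close> an attachment \<open>t w\<close> of its own, visible from the component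
      of \<open>B - {w0}\<close> around \<open>X\<close>; so that component sees at least \<open>3\<close> attachments.\<close>
    let ?S = "t ` (?W - {w0})"
    have "inj_on t (?W - {w0})"
    proof (rule inj_onI)
      fix w w' assume w: "w \<in> ?W - {w0}" "w' \<in> ?W - {w0}" "t w = t w'"
      then show "w = w'" using cross[of w w'] t(2)[of w] by auto
    qed
    then have "card ?S = card ?W - 1" using w0 finB by (simp add: card_image)
    moreover have "?S \<inter> att ?Z X = {}"
      using t(2) att_mono[OF Kf(1)] by blast
    then have "card (?S \<union> att ?Z X) = card ?S + card (att ?Z X)"
      by (intro card_Un_disjoint fin_att) (use finB in auto)
    moreover have "?S \<union> att ?Z X \<subseteq> att ?Z (Kf w0)"
      using cross[OF w0] att_mono[OF Kf(1)[OF w0]] by blast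
    then have "card (?S \<union> att ?Z X) \<le> card (att ?Z (Kf w0))" by (rule card_mono[OF fin_att])
    ultimately show False using four att2[OF w0] by linarith
  qed
  have "minimal_attachment V E zs B"
  proof
    fix L assume L: "conn L" "L \<subset> B"
    then obtain v where "v \<in> B" "v \<notin> L" by blast
    then show "card (att ?Z L) \<le> 2" using few[of v L] L BA by blast
  qed (use zs B in auto)
  then show thesis using that B by blast
qed

end

section \<open>Translation to the library's connectedness, and the theorem\<close>

lemma (in simple_graph) conn_iff_connected:
  assumes G: "pverts G = V" "parcs G = E" and S: "S \<subseteq> V"
  shows "Digraph_Component.connected (with_proj G \<restriction> S) \<longleftrightarrow> conn S"
proof -
  let ?R = "E \<inter> S \<times> S"
  have R: "symcl (arcs_ends (with_proj G \<restriction> S)) = ?R"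
    using G E_sym by (auto simp: arcs_ends_conv symcl_def)
  have "Digraph_Component.connected (with_proj G \<restriction> S) \<longleftrightarrow>
      S \<noteq> {} \<and> (\<forall>u\<in>S. \<forall>v\<in>S. (u, v) \<in> rtrancl_on S ?R)"
    unfolding connected_conv R by simp
  also have "\<dots> \<longleftrightarrow> conn S"
  proof (intro iffI conjI ballI)
    assume *: "S \<noteq> {} \<and> (\<forall>u\<in>S. \<forall>v\<in>S. (u, v) \<in> rtrancl_on S ?R)"
    show "conn S"
      unfolding conn_def
    proof (intro conjI allI impI)
      fix X assume X: "X \<subseteq> S" "X \<noteq> {} \<and> X \<noteq> S"
      then obtain x y where xy: "x \<in> X" "y \<in> S" "y \<notin> X" by blast
      \<comment> \<open>A walk starting in \<open>X\<close> either stays in \<open>X\<close> or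
        reveals a crossing edge.\<close>
      have step: "z \<in> X \<or> (\<exists>a\<in>X. \<exists>b\<in>S - X. (a, b) \<in> E)"
        if "(x, z) \<in> rtrancl_on S ?R" for z
        using that
      proof (induction rule: rtrancl_on_induct)
        case base
        then show ?case using xy(1) by blast
      next
        case (step b c)
        then show ?case by blast
      qed
      have "(x, y) \<in> rtrancl_on S ?R" using * X xy by blast
      from step[OF this] show "\<exists>a\<in>X. \<exists>b\<in>S - X. (a, b) \<in> E" using xy(3) by blast
    qed (use * in simp)
  next
    assume S: "conn S"
    then show "S \<noteq> {}" by (rule conn_nonempty)
    fix u v assume uv: "u \<in> S" "v \<in> S"
    let ?X = "{y \<in> S. (u, y) \<in> rtrancl_on S ?R}"
    show "(u, v) \<in> rtrancl_on S ?R"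
    proof (rule ccontr)
      assume "\<not> ?thesis"
      then obtain a b where "a \<in> ?X" "b \<in> S" "b \<notin> ?X" "(a, b) \<in> E"
        using connD[OF S, of ?X u v] uv by blast
      then show False by (auto intro: rtrancl_on_into_rtrancl_on)
    qed
  qed
  finally show ?thesis .
qed

theorem theorem4:
  fixes G :: "'a pair_pre_digraph" and x :: 'a
  assumes "pair_graph G"
    and "vertex_connected 4 (with_proj G)"
    and "x \<in> pverts G"
  shows "\<exists>H :: 'a pair_pre_digraph.
           induced_subgraph (with_proj H) (with_proj G) \<and>
           ((\<exists>l \<ge> 3. iso_to_subdivision H (wheel l)) \<or>
            iso_to_subdivision H prism \<or>
            (\<exists>K :: nat pair_pre_digraph.
               complete_bipartite_digraph 3 3 (with_proj K) \<and> iso_to_subdivision H K)) \<and>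
           Digraph_Component.connected (delete_verts (with_proj G) (pverts H)) \<and>
           x \<in> verts (delete_verts (with_proj G) (pverts H))"
proof -
  interpret G: pair_graph G by (rule assms(1))
  let ?V = "pverts G" and ?E = "parcs G"
  interpret simple_graph ?V ?E
  proof
    show "?E \<subseteq> ?V \<times> ?V" using G.in_arcsD1 G.in_arcsD2 by auto
    show "(b, a) \<in> ?E" if "(a, b) \<in> ?E" for a b using that by (rule G.arcs_symmetric)
    show "(a, a) \<notin> ?E" for a using G.no_loops by fastforce
  qed (rule G.pair_finite_verts)
  interpret four_connected ?V ?E
  proof
    show "card ?V > 4" using assms(2) by (simp add: vertex_connected_def)
    show "conn (?V - S)" if "S \<subseteq> ?V" "card S < 4" for S
    proof -
      have "Digraph_Component.connected (with_proj G \<restriction> (?V - S))"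
        using assms(2) that by (simp add: vertex_connected_def delete_verts_def)
      then show ?thesis using conn_iff_connected[of G "?V - S"] by simp
    qed
  qed
  obtain zs where zs: "icycle zs" "set zs \<subseteq> ?V" "x \<notin> set zs" "conn (?V - set zs)"
    using nonseparating_induced_cycle[OF assms(3)] by blast
  obtain B where B: "minimal_attachment ?V ?E zs B" "x \<notin> B" "conn (?V - set zs - B)"
    using minimal_attachment_exists[OF zs(1,2) assms(3) zs(3,4)] by blast
  interpret minimal_attachment ?V ?E zs B by (rule B(1))
  let ?U = "set zs \<union> B"
  let ?H = "ugraph (?E \<inter> ?U \<times> ?U)"
  have arcs_H: "parcs ?H = ?E \<inter> ?U \<times> ?U"
    using E_sym by (auto simp: in_symcl_iff)
  \<comment> \<open>\<open>ugraph\<close> drops isolated vertices, so each vertex of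
    \<open>?U\<close> needs an edge inside \<open>?U\<close>: from the cycle, from connectedness of
    \<open>B\<close>, or from an attachment if \<open>B\<close> is a single vertex.\<close>
  have "Field (?E \<inter> ?U \<times> ?U) = ?U"
  proof
    have "set zs \<subseteq> Field (?E \<inter> set zs \<times> set zs)"
      unfolding edges_zs Field_symcl using Field_cedges[of zs] length_zs by simp
    also have "\<dots> \<subseteq> Field (?E \<inter> ?U \<times> ?U)" by (rule mono_Field) blast
    finally have "set zs \<subseteq> Field (?E \<inter> ?U \<times> ?U)" .
    moreover have "b \<in> Field (?E \<inter> ?U \<times> ?U)" if b: "b \<in> B" for b
    proof -
      have "\<exists>c\<in>?U. (b, c) \<in> ?E"
      proof (cases "B = {b}")
        case True
        have "att (set zs) B \<noteq> {}" using att_B by auto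
        then show ?thesis using True by (auto simp: att_def)
      next
        case False
        then obtain c where "c \<in> B" "c \<noteq> b" using b by blast
        then obtain a d where "a \<in> {b}" "d \<in> B" "d \<notin> {b}" "(a, d) \<in> ?E"
          by (metis connD[OF conn_B] b empty_subsetI insert_subset singletonD singletonI)
        then show ?thesis by blast
      qed
      then show ?thesis using b by (auto simp: Field_def)
    qed
    ultimately show "?U \<subseteq> Field (?E \<inter> ?U \<times> ?U)" by blast
  qed (auto simp: Field_def)
  then have verts_H: "pverts ?H = ?U" by simp
  have "wf_digraph (with_proj ?H)"
    using pair_wf_digraph_ugraph by (simp only: wf_digraph_wp_iff)
  then have "induced_subgraph (with_proj ?H) (with_proj G)"
    unfolding induced_subgraph_def subgraph_def
    using G.wf_digraph_axioms arcs_H verts_H zs(2) B_V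
    by (auto simp: compatibleI_with_proj simp del: ugraph_simps)
  moreover have "wheel_prism_K33 ?H" by (rule induced_subdivision)
  moreover have "delete_verts (with_proj G) (pverts ?H) = with_proj G \<restriction> (?V - set zs - B)"
    unfolding delete_verts_def verts_H with_proj_simps Diff_eq Compl_Un Int_assoc ..
  moreover have "Digraph_Component.connected (with_proj G \<restriction> (?V - set zs - B))"
    using conn_iff_connected[of G "?V - set zs - B"] B(3) by auto
  moreover have "x \<in> ?V - set zs - B" using assms(3) zs(3) B(2) by blast
  ultimately show ?thesis
    unfolding wheel_prism_K33_def by (intro exI[of _ ?H]) simp
qed

end
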